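(* Algorithm SquareImp is a $\frac32$-approximation algorithm for wMIS on weighted $\{2,3\}$-intersection graphs: for every weighted $\{2,3\}$-intersection graph $(G,w)$, SquareImp runs in time polynomial in the number of vertices of $G$ and returns an independent set $A$ of $G$ with $w(A^* )\le \frac32\,w(A)$, where $A^*$ is an independent set of $G$ of maximum weight.
   Context: A hereditary $\{2,3\}$-collection is a pair $(V,U)$ with $V$ finite and $U=\{U_v:v\in V\}$ a collection of sets of size 2 or 3 such that for each $v\in V$ with $U_v=\{a,b,c\}$ there are $v_a,v_b,v_c\in V$ with $U_{v_a}=\{b,c\}$, $U_{v_b}=\{a,c\}$, $U_{v_c}=\{a,b\}$. Its weighted $\{2,3\}$-intersection graph $(G,w)$ is the multigraph on $V$ with $|U_x\cap U_y|$ parallel edges between distinct $x,y$ (adjacent iff $U_x\cap U_y\ne\emptyset$), with vertex weights $w_v=|U_v|-1$. wMIS: given a graph with positive vertex weights, find an independent set $S$ maximizing $w(S)=\sum_{v\in S}w_v$. A $d$-claw is an induced subgraph $C$ consisting of an independent set $T_C$ of $d$ vertices and a center vertex adjacent to all of them; a single vertex is a 1-claw with $T_C$ equal to that vertex and no center. $N(S)$ is the set of vertices adjacent to some vertex of $S$. For a vertex set $S$, $w^2(S)=\sum_{v\in S}w_v^2$. For an independent set $A$, a claw $C$ (of any size $d$) improves $w^2(A)$ if $w^2(A)<w^2((A\cup T_C)\setminus N(T_C))$. Algorithm SquareImp$(G,w)$: start with $A=\emptyset$; while there is a claw $C$ in $G$ such that $T_C$ improves $w^2(A)$, set $A\leftarrow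 (A\cup T_C)\setminus N(T_C)$ (any such claw may be chosen); return $A$. *)

theory Defs
  imports Complex_Main "HOL-Computational_Algebra.Polynomial"
begin

section \<open>Graphs, independent sets and claws\<close>

text \<open>A finite undirected loopless multigraph is given by its vertices and the number of parallel
  edges between any two of them.\<close>

record 'v mgraph =
  verts :: "'v set"
  mult :: "'v \<Rightarrow> 'v \<Rightarrow> nat"

definition adj :: "'v mgraph \<Rightarrow> 'v \<Rightarrow> 'v \<Rightarrow> bool" where
  "adj G x y \<longleftrightarrow> x \<in> verts G \<and> y \<in> verts G \<and> mult G x y > 0"

definition neighbours :: "'v mgraph \<Rightarrow> 'v set \<Rightarrow> 'v set" where
  "neighbours G S = {y \<in> verts G. \<exists>x\<in>S. adj G x y}"

definition independent_set :: "'v mgraph \<Rightarrow> 'v set \<Rightarrow> bool" where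
  "independent_set G S \<longleftrightarrow> S \<subseteq> verts G \<and> (\<forall>x\<in>S. \<forall>y\<in>S. \<not> adj G x y)"

definition weight :: "('v \<Rightarrow> nat) \<Rightarrow> 'v set \<Rightarrow> nat" where
  "weight w S = (\<Sum>v\<in>S. w v)"

definition weight2 :: "('v \<Rightarrow> nat) \<Rightarrow> 'v set \<Rightarrow> nat" where
  "weight2 w S = (\<Sum>v\<in>S. (w v)\<^sup>2)"

definition is_wMIS :: "'v mgraph \<Rightarrow> ('v \<Rightarrow> nat) \<Rightarrow> 'v set \<Rightarrow> bool" where
  "is_wMIS G w S \<longleftrightarrow>
     independent_set G S \<and> (\<forall>S'. independent_set G S' \<longrightarrow> weight w S' \<le> weight w S)"

text \<open>An induced subgraph is determined by its vertices, so a \<open>d\<close>-claw is represented by its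
  (optional) center and its set \<open>T\<close> of \<open>d\<close> talons.\<close>

definition is_claw :: "'v mgraph \<Rightarrow> nat \<Rightarrow> 'v option \<Rightarrow> 'v set \<Rightarrow> bool" where
  "is_claw G d center T \<longleftrightarrow>
     (case center of
        None \<Rightarrow> d = 1 \<and> (\<exists>v\<in>verts G. T = {v})
      | Some z \<Rightarrow> z \<in> verts G \<and> independent_set G T \<and> finite T \<and> card T = d
                  \<and> (\<forall>t\<in>T. adj G z t))"


section \<open>Weighted intersection graphs of hereditary collections\<close>

text \<open>The collection is indexed by its vertices; the indexing need not be injective.\<close>

definition hereditary_23_collection :: "'v set \<Rightarrow> ('v \<Rightarrow> 'a set) \<Rightarrow> bool" where
  "hereditary_23_collection V U \<longleftrightarrow>
     finite V \<and>
     (\<forall>v\<in>V. card (U v) = 2 \<or> card (U v) = 3) \<and>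
     (\<forall>v\<in>V. \<forall>a b c. a \<noteq> b \<and> a \<noteq> c \<and> b \<noteq> c \<and> U v = {a, b, c} \<longrightarrow>
        (\<exists>va\<in>V. \<exists>vb\<in>V. \<exists>vc\<in>V. U va = {b, c} \<and> U vb = {a, c} \<and> U vc = {a, b}))"

definition intersection_graph :: "'v set \<Rightarrow> ('v \<Rightarrow> 'a set) \<Rightarrow> 'v mgraph" where
  "intersection_graph V U =
     \<lparr>verts = V,
      mult = (\<lambda>x y. if x \<in> V \<and> y \<in> V \<and> x \<noteq> y then card (U x \<inter> U y) else 0)\<rparr>"

definition intersection_weight :: "('v \<Rightarrow> 'a set) \<Rightarrow> 'v \<Rightarrow> nat" where
  "intersection_weight U v = card (U v) - 1"


section \<open>The algorithm SquareImp\<close>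

definition exchange :: "'v mgraph \<Rightarrow> 'v set \<Rightarrow> 'v set \<Rightarrow> 'v set" where
  "exchange G A T = (A \<union> T) - neighbours G T"

definition improves :: "'v mgraph \<Rightarrow> ('v \<Rightarrow> nat) \<Rightarrow> 'v set \<Rightarrow> 'v set \<Rightarrow> bool" where
  "improves G w T A \<longleftrightarrow> weight2 w A < weight2 w (exchange G A T)"

text \<open>One iteration of the while loop; it is a relation because any improving claw may be
  chosen.\<close>

definition squareimp_step ::
    "'v mgraph \<Rightarrow> ('v \<Rightarrow> nat) \<Rightarrow> 'v set \<Rightarrow> 'v set \<Rightarrow> bool" where
  "squareimp_step G w A A' \<longleftrightarrow>
     (\<exists>d center T. is_claw G d center T \<and> improves G w T A \<and> A' = exchange G A T)"

definition squareimp_returns :: "'v mgraph \<Rightarrow> ('v \<Rightarrow> nat) \<Rightarrow> 'v set \<Rightarrow> bool" where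
  "squareimp_returns G w A \<longleftrightarrow>
     (squareimp_step G w)\<^sup>*\<^sup>* {} A \<and> \<not> (\<exists>A'. squareimp_step G w A A')"


section \<open>Running time\<close>

text \<open>Running time is measured on a structured random access machine with unit costs. A state
  consists of registers and memory, both holding natural numbers. The machine can add and subtract
  (with truncation at 0) but not multiply: with unit-cost multiplication, polynomially many steps
  could produce numbers with exponentially many digits, and unit cost would no longer be
  polynomially related to bit cost.\<close>

type_synonym ram_state = "(nat \<Rightarrow> nat) \<times> (nat \<Rightarrow> nat)"

datatype ram =
    Skip
  | SetC nat nat       \<comment> \<open>register := constant\<close>
  | AddR nat nat nat   \<comment> \<open>register := register + register\<close>
  | SubR nat nat nat   \<comment> \<open>register := register - register\<close>
  | Load nat nat       \<comment> \<open>register := memory cell addressed by register\<close>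
  | Store nat nat      \<comment> \<open>memory cell addressed by register := register\<close>
  | Seq ram ram
  | IfNZ nat ram ram   \<comment> \<open>branch on register being nonzero\<close>
  | WhileNZ nat ram    \<comment> \<open>loop while register is nonzero\<close>

text \<open>\<open>exec P s t s'\<close>: started in state \<open>s\<close>, the program \<open>P\<close> halts after \<open>t\<close> steps
  in state \<open>s'\<close>.\<close>

inductive exec :: "ram \<Rightarrow> ram_state \<Rightarrow> nat \<Rightarrow> ram_state \<Rightarrow> bool" where
  Skip: "exec Skip s 1 s"
| SetC: "exec (SetC x c) (r, m) 1 (r(x := c), m)"
| AddR: "exec (AddR x y z) (r, m) 1 (r(x := r y + r z), m)"
| SubR: "exec (SubR x y z) (r, m) 1 (r(x := r y - r z), m)"
| Load: "exec (Load x y) (r, m) 1 (r(x := m (r y)), m)"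
| Store: "exec (Store x y) (r, m) 1 (r, m(r x := r y))"
| Seq: "exec P s t s' \<Longrightarrow> exec Q s' t' s'' \<Longrightarrow> exec (Seq P Q) s (t + t') s''"
| IfTrue: "fst s x \<noteq> 0 \<Longrightarrow> exec P s t s' \<Longrightarrow> exec (IfNZ x P Q) s (1 + t) s'"
| IfFalse: "fst s x = 0 \<Longrightarrow> exec Q s t s' \<Longrightarrow> exec (IfNZ x P Q) s (1 + t) s'"
| WhileFalse: "fst s x = 0 \<Longrightarrow> exec (WhileNZ x P) s 1 s"
| WhileTrue: "fst s x \<noteq> 0 \<Longrightarrow> exec P s t s' \<Longrightarrow> exec (WhileNZ x P) s' t' s''
     \<Longrightarrow> exec (WhileNZ x P) s (1 + t + t') s''"

inductive_cases exec_SkipE: "exec Skip s t s'"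
inductive_cases exec_SetCE: "exec (SetC x c) s t s'"
inductive_cases exec_AddRE: "exec (AddR x y z) s t s'"
inductive_cases exec_SubRE: "exec (SubR x y z) s t s'"
inductive_cases exec_LoadE: "exec (Load x y) s t s'"
inductive_cases exec_StoreE: "exec (Store x y) s t s'"
inductive_cases exec_SeqE: "exec (Seq P Q) s t s'"
inductive_cases exec_IfNZE: "exec (IfNZ x P Q) s t s'"
inductive_cases exec_WhileNZE: "exec (WhileNZ x P) s t s'"

lemma exec_deterministic:
  "exec P s t s' \<Longrightarrow> exec P s u s'' \<Longrightarrow> u = t \<and> s'' = s'"
proof (induction P s t s' arbitrary: u s'' rule: exec.induct)
  case (Seq P s t s' Q t' s1)
  from Seq.prems obtain u1 z u2 where
    "u = u1 + u2" "exec P s u1 z" "exec Q z u2 s''" by (rule exec_SeqE)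
  with Seq.IH(1)[of u1 z] Seq.IH(2)[of u2 s''] show ?case by simp
next
  case (IfTrue s x P t s' Q)
  from IfTrue.prems obtain u1 where "u = Suc u1" "exec P s u1 s''"
    by (rule exec_IfNZE) (use IfTrue.hyps(1) in fastforce)+
  with IfTrue.IH[of u1 s''] show ?case by simp
next
  case (IfFalse s x Q t s' P)
  from IfFalse.prems obtain u1 where "u = Suc u1" "exec Q s u1 s''"
    by (rule exec_IfNZE) (use IfFalse.hyps(1) in fastforce)+
  with IfFalse.IH[of u1 s''] show ?case by simp
next
  case (WhileFalse s x P)
  from WhileFalse.prems show ?case
    by (rule exec_WhileNZE) (use WhileFalse.hyps in fastforce)+
next
  case (WhileTrue s x P t s' t' s1)
  from WhileTrue.prems obtain u1 z u2 where
    "u = Suc (u1 + u2)" "exec P s u1 z" "exec (WhileNZ x P) z u2 s''"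
    by (rule exec_WhileNZE) (use WhileTrue.hyps(1) in fastforce)+
  with WhileTrue.IH(1)[of u1 z] WhileTrue.IH(2)[of u2 s''] show ?case by simp
next
  case Skip
  then show ?case by (rule exec_SkipE) simp
next
  case SetC
  then show ?case by (rule exec_SetCE) simp
next
  case AddR
  then show ?case by (rule exec_AddRE) simp
next
  case SubR
  then show ?case by (rule exec_SubRE) simp
next
  case Load
  then show ?case by (rule exec_LoadE) simp
next
  case Store
  then show ?case by (rule exec_StoreE) simp
qed

text \<open>The vertices are numbered \<open>0, \<dots>, n - 1\<close> by \<open>f\<close>. On input, register 0 holds \<open>n\<close>
  and the memory holds the \<open>n \<times> n\<close> matrix of edge multiplicities, row by row, followed by the
  \<open>n\<close> weights; everything else is 0. On output, the \<open>n\<close> cells after the weights mark the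
  members of the returned set.\<close>

definition ram_input ::
    "'v mgraph \<Rightarrow> ('v \<Rightarrow> nat) \<Rightarrow> nat \<Rightarrow> (nat \<Rightarrow> 'v) \<Rightarrow> ram_state" where
  "ram_input G w n f =
     ((\<lambda>_. 0)(0 := n),
      (\<lambda>i. if i < n * n then mult G (f (i div n)) (f (i mod n))
           else if i < n * n + n then w (f (i - n * n))
           else 0))"

definition ram_output :: "nat \<Rightarrow> (nat \<Rightarrow> 'v) \<Rightarrow> ram_state \<Rightarrow> 'v set" where
  "ram_output n f s = f ` {i. i < n \<and> snd s (n * n + n + i) \<noteq> 0}"

definition implements_squareimp ::
    "ram \<Rightarrow> 'v mgraph \<Rightarrow> ('v \<Rightarrow> nat) \<Rightarrow> nat \<Rightarrow> bool" where
  "implements_squareimp P G w time_bound \<longleftrightarrow>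
     (\<forall>f. bij_betw f {..<card (verts G)} (verts G) \<longrightarrow>
        (\<exists>t s. exec P (ram_input G w (card (verts G)) f) t s \<and> t \<le> time_bound \<and>
               squareimp_returns G w (ram_output (card (verts G)) f s)))"

end

theory Submission
  imports Defs
begin

text \<open>Ratio: let \<open>A\<close> be locally optimal and \<open>B\<close> independent. Every pair of the collection meets an
  element covered by \<open>A\<close>, hence, the collection being hereditary, a set of \<open>B\<close> has at most one
  uncovered element; moreover a triple of \<open>B\<close> meets a triple of \<open>A\<close>. Give the share 2 to the
  elements of the triples of \<open>A\<close> and to the covered elements of those sets of \<open>B\<close> that have an
  uncovered element, and the share 1 to the other covered elements. Then each \<open>u\<close> in \<open>B\<close> receives at
  least \<open>2 * w u\<close>, while each \<open>v\<close> in \<open>A\<close> provides at most \<open>3 * w v\<close>, since a pair of \<open>A\<close> with two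
  elements of share 2 would be the center of an improving claw.

  Running time: talons of a claw are disjoint and meet the set of the center, so there are at most
  three of them and all claws can be enumerated. Each exchange increases the squared weight, which
  is at most \<open>4 * n\<close>. The enumeration is written in a small language of bounded loops, which is
  compiled to the random access machine.\<close>

section \<open>Intersection graphs\<close>

locale collection =
  fixes V :: "'v set" and U :: "'v \<Rightarrow> 'a set"
  assumes hereditary: "hereditary_23_collection V U"
begin

abbreviation "G \<equiv> intersection_graph V U"
abbreviation "w \<equiv> intersection_weight U"

lemma finite_V: "finite V"
  using hereditary by (simp add: hereditary_23_collection_def)

lemma card_U: "v \<in> V \<Longrightarrow> card (U v) = 2 \<or> card (U v) = 3"
  using hereditary by (simp add: hereditary_23_collection_def)

lemma finite_U: "v \<in> V \<Longrightarrow> finite (U v)"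
  using card_U by (metis card.infinite zero_neq_numeral)

lemma verts_G [simp]: "verts G = V"
  by (simp add: intersection_graph_def)

lemma adj_iff: "adj G x y \<longleftrightarrow> x \<in> V \<and> y \<in> V \<and> x \<noteq> y \<and> U x \<inter> U y \<noteq> {}"
  using finite_U by (auto simp: adj_def intersection_graph_def card_gt_0_iff)

lemma independent_disjoint:
  assumes "independent_set G S" "x \<in> S" "y \<in> S" "x \<noteq> y"
  shows "U x \<inter> U y = {}"
  using assms by (auto simp: independent_set_def adj_iff)

lemma weight_cases: "v \<in> V \<Longrightarrow> w v = 1 \<and> card (U v) = 2 \<or> w v = 2 \<and> card (U v) = 3"
  using card_U by (fastforce simp: intersection_weight_def)

text \<open>This is where heredity enters. A pair \<open>v\<close> is its own witness; in a triple,
  \<open>c\<close> is the remaining element and heredity supplies the pair without it.\<close>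

lemma exists_pair:
  assumes "v \<in> V" "a \<in> U v" "b \<in> U v" "a \<noteq> b"
  obtains x where "x \<in> V" "U x = {a, b}"
proof (cases "card (U v) = 2")
  case True
  then have "U v = {a, b}"
    using assms finite_U[of v] by (auto simp: card_2_iff)
  then show ?thesis
    using assms that by blast
next
  case False
  then have "card (U v) = 3"
    using card_U assms by blast
  then have "card (U v - {a, b}) = 1"
    using assms finite_U[of v] by (simp add: card_Diff_subset)
  then obtain c where "U v - {a, b} = {c}"
    by (auto simp: card_1_singleton_iff)
  then have "U v = {a, b, c}" "a \<noteq> c" "b \<noteq> c"
    using assms by auto
  with assms hereditary that show ?thesis
    unfolding hereditary_23_collection_def by metis
qed

section \<open>Exchange steps, their number, and the shape of improving claws\<close>

lemma independent_exchange:
  assumes "independent_set G A" "is_claw G d c T"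
  shows "independent_set G (exchange G A T)"
proof -
  have "T \<subseteq> V" "\<And>x y. x \<in> T \<Longrightarrow> y \<in> T \<Longrightarrow> \<not> adj G x y"
    using assms(2) by (auto simp: is_claw_def independent_set_def adj_iff split: option.splits)
  moreover have "adj G x y \<Longrightarrow> x \<in> V \<and> y \<in> V \<and> adj G y x" for x y
    by (auto simp: adj_iff)
  ultimately show ?thesis
    using assms(1) unfolding exchange_def independent_set_def neighbours_def verts_G by blast
qed

lemma squareimp_step_independent:
  "independent_set G A \<Longrightarrow> squareimp_step G w A A' \<Longrightarrow> independent_set G A'"
  unfolding squareimp_step_def using independent_exchange by blast

lemma squareimp_steps_independent:
  "(squareimp_step G w)\<^sup>*\<^sup>* A A' \<Longrightarrow> independent_set G A \<Longrightarrow> independent_set G A'"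
  by (induction rule: rtranclp_induct) (auto intro: squareimp_step_independent)

lemma independent_empty: "independent_set G {}"
  by (simp add: independent_set_def)

lemma weight2_le: "S \<subseteq> V \<Longrightarrow> weight2 w S \<le> 4 * card V"
proof -
  assume S: "S \<subseteq> V"
  have "weight2 w S \<le> (\<Sum>v\<in>S. 4)"
    unfolding weight2_def using S weight_cases by (intro sum_mono) force
  also have "\<dots> \<le> 4 * card V"
    using card_mono[OF finite_V S] by simp
  finally show ?thesis .
qed

lemma squareimp_step_weight2: "squareimp_step G w A A' \<Longrightarrow> weight2 w A < weight2 w A'"
  by (auto simp: squareimp_step_def improves_def)

lemma squareimp_steps_weight2:
  "(squareimp_step G w)\<^sup>*\<^sup>* A A' \<Longrightarrow> A' = A \<or> weight2 w A < weight2 w A'"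
  by (induction rule: rtranclp_induct) (auto dest: squareimp_step_weight2)

text \<open>The squared weight is a natural number that every step increases, so \<open>k\<close>
  steps make it at least \<open>k\<close>, whichever claws are chosen.\<close>

lemma squareimp_steps_bound:
  assumes "(squareimp_step G w ^^ k) {} A"
  shows "k \<le> 4 * card V"
proof -
  have "k \<le> weight2 w A"
    using assms by (induction k arbitrary: A) (fastforce dest: squareimp_step_weight2)+
  moreover have "A \<subseteq> V"
    using squareimp_steps_independent[OF relpowp_imp_rtranclp[OF assms] independent_empty]
    by (simp add: independent_set_def)
  ultimately show ?thesis
    using weight2_le le_trans by blast
qed

text \<open>The talons of a claw with center \<open>z\<close> meet \<open>U z\<close> in disjoint nonempty sets.\<close>

lemma claw_card_le_3:
  assumes "is_claw G d (Some z) T"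
  shows "card T \<le> 3"
proof -
  have z: "z \<in> V" and T: "independent_set G T" "\<And>t. t \<in> T \<Longrightarrow> U t \<inter> U z \<noteq> {}"
    using assms by (auto simp: is_claw_def adj_iff)
  then have "\<forall>t\<in>T. \<exists>e. e \<in> U t \<inter> U z"
    by blast
  then obtain g where g: "\<And>t. t \<in> T \<Longrightarrow> g t \<in> U t \<inter> U z"
    by metis
  have "inj_on g T"
    using g independent_disjoint[OF T(1)] by (auto intro!: inj_onI) (metis IntE disjoint_iff)
  then have "card T \<le> card (U z)"
    using g finite_U[OF z] by (intro card_inj_on_le[of g]) auto
  with card_U[OF z] show ?thesis by auto
qed

text \<open>Brings every improving claw into a form that four bounded loops can enumerate: with
  fewer than three talons one of them is repeated, and a claw without center takes its only talon as
  \<open>z\<close>.\<close>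

lemma improving_claw_triple:
  assumes "is_claw G d c T" "improves G w T A"
  obtains z x y u where "{z, x, y, u} \<subseteq> V" "T = {x, y, u}" "independent_set G T"
    "\<And>t. t \<in> T \<Longrightarrow> t = z \<or> adj G z t"
proof (cases c)
  case None
  then obtain v where "v \<in> V" "T = {v}"
    using assms by (auto simp: is_claw_def)
  with that[of v v v v] show ?thesis
    by (auto simp: independent_set_def adj_iff)
next
  case (Some z)
  with assms have T: "z \<in> V" "independent_set G T" "\<And>t. t \<in> T \<Longrightarrow> adj G z t" "finite T"
    by (auto simp: is_claw_def)
  have "T \<noteq> {}"
    using assms(2) by (auto simp: improves_def exchange_def neighbours_def)
  then have "card T \<noteq> 0"
    using T(4) by simp
  moreover have "card T \<le> 3"
    using claw_card_le_3 assms(1) Some by blast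
  ultimately consider "card T = 1" | "card T = 2" | "card T = 3"
    by linarith
  then have "\<exists>x y u. T = {x, y, u}"
  proof cases
    case 1
    then obtain x where "T = {x, x, x}" by (auto simp: card_1_singleton_iff)
    then show ?thesis by blast
  next
    case 2
    then obtain x y where "T = {x, x, y}" by (auto simp: card_2_iff)
    then show ?thesis by blast
  next
    case 3
    then show ?thesis by (auto simp: card_3_iff)
  qed
  then obtain x y u where xyu: "T = {x, y, u}"
    by blast
  have "T \<subseteq> V" using T(2) by (simp add: independent_set_def)
  show ?thesis
  proof (rule that)
    show "{z, x, y, u} \<subseteq> V" using T(1) xyu \<open>T \<subseteq> V\<close> by blast
    show "t = z \<or> adj G z t" if "t \<in> T" for t using T(3)[OF that] ..
  qed fact+
qed

text \<open>Conversely, if \<open>z\<close> is a talon, independence excludes every other talon, and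
  what remains is a claw without center.\<close>

lemma triple_claw:
  assumes "z \<in> V" "independent_set G T" "finite T" "T \<noteq> {}" "\<And>t. t \<in> T \<Longrightarrow> t = z \<or> adj G z t"
  shows "\<exists>d c. is_claw G d c T"
proof (cases "z \<in> T")
  case True
  then have "T = {z}"
    using assms(2,5) unfolding independent_set_def by blast
  with assms(1) show ?thesis
    by (intro exI[of _ 1] exI[of _ None]) (auto simp: is_claw_def)
next
  case False
  then have "\<forall>t\<in>T. adj G z t"
    using assms(5) by metis
  with assms(1-3) show ?thesis
    by (intro exI[of _ "card T"] exI[of _ "Some z"]) (auto simp: is_claw_def)
qed

section \<open>The approximation ratio\<close>

text \<open>The sets of distinct vertices in \<open>S\<close> are disjoint, so no element is counted
  twice.\<close>

lemma independent_sum_Union: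
  fixes h :: "'a \<Rightarrow> nat"
  assumes "independent_set G S"
  shows "(\<Sum>v\<in>S. \<Sum>e\<in>U v. h e) = (\<Sum>e\<in>(\<Union>v\<in>S. U v). h e)"
proof -
  have S: "S \<subseteq> V" using assms by (simp add: independent_set_def)
  show ?thesis
    by (rule sum.UNION_disjoint[symmetric])
       (use S finite_V finite_U independent_disjoint[OF assms] in \<open>auto intro: finite_subset\<close>)
qed

section \<open>Consequences of local optimality\<close>

context
  fixes A
  assumes indep_A: "independent_set G A"
    and local_opt: "\<And>A'. \<not> squareimp_step G w A A'"
begin

lemma A_subset: "A \<subseteq> V"
  using indep_A by (simp add: independent_set_def)

lemma no_improving_claw: "is_claw G d c T \<Longrightarrow> \<not> improves G w T A"
  using local_opt by (auto simp: squareimp_step_def)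

definition covered :: "'a set" where
  "covered = (\<Union>v\<in>A. U v)"

text \<open>The exchange adds all of \<open>T\<close> and removes exactly its neighbours in
  \<open>A\<close>, so the inequality is the failure of \<open>T\<close> to improve. All later uses
  of local optimality go through it.\<close>

lemma claw_weight2_le:
  assumes "is_claw G d c T" "T \<inter> A = {}"
  shows "weight2 w T \<le> weight2 w (A \<inter> neighbours G T)"
proof -
  have T: "T \<subseteq> V" "T \<inter> neighbours G T = {}"
    using assms(1)
    by (auto simp: is_claw_def independent_set_def neighbours_def adj_iff split: option.splits)
  have fin: "finite A" "finite T"
    using A_subset T finite_V finite_subset by blast+
  have "exchange G A T = (A - neighbours G T) \<union> T"
    using T by (auto simp: exchange_def)
  then have "weight2 w (exchange G A T) = weight2 w (A - neighbours G T) + weight2 w T"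
    using fin assms(2) by (simp add: weight2_def, subst sum.union_disjoint) auto
  moreover have "weight2 w A = weight2 w (A - neighbours G T) + weight2 w (A \<inter> neighbours G T)"
    using fin unfolding weight2_def by (metis sum.Int_Diff add.commute)
  ultimately show ?thesis
    using no_improving_claw[OF assms(1)] by (simp add: improves_def)
qed

lemma single_claw_weight2_le:
  assumes "x \<in> V" "x \<notin> A"
  shows "(w x)\<^sup>2 \<le> weight2 w (A \<inter> neighbours G {x})"
  using claw_weight2_le[of 1 None "{x}"] assms by (simp add: is_claw_def weight2_def)

text \<open>A vertex outside \<open>A\<close> without neighbours in \<open>A\<close> would, as a
  claw without center, improve \<open>A\<close> by its positive weight.\<close>

lemma meets_covered:
  assumes "x \<in> V"
  shows "U x \<inter> covered \<noteq> {}"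
proof (cases "x \<in> A")
  case True
  then have "U x \<subseteq> covered" by (auto simp: covered_def)
  moreover have "U x \<noteq> {}" using card_U[OF assms] by auto
  ultimately show ?thesis by blast
next
  case False
  have "A \<inter> neighbours G {x} \<noteq> {}"
  proof
    assume "A \<inter> neighbours G {x} = {}"
    then have "w x = 0"
      using single_claw_weight2_le[OF assms False] by (simp add: weight2_def)
    with weight_cases[OF assms] show False by simp
  qed
  then show ?thesis
    by (auto simp: neighbours_def adj_iff covered_def)
qed

text \<open>Two uncovered elements would, by heredity, form a pair of the collection that avoids
  \<open>covered\<close>.\<close>

lemma card_uncovered:
  assumes "x \<in> V"
  shows "card (U x - covered) \<le> 1"
proof (rule ccontr)
  assume "\<not> ?thesis"
  then have "card (U x - covered) \<ge> 2" by simp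
  then obtain a b where "a \<in> U x - covered" "b \<in> U x - covered" "a \<noteq> b"
    by (metis card_le_Suc0_iff_eq finite_U[OF assms] finite_Diff not_less_eq_eq numeral_2_eq_2)
  then show False
    using exists_pair[OF assms, of a b] meets_covered by (metis DiffE IntE ex_in_conv insertE singletonD)
qed

text \<open>A triple outside \<open>A\<close> has squared weight 4. If it met only pairs of
  \<open>A\<close>, these would be the talons of a claw with center \<open>x\<close>, hence at most
  three of squared weight 1 each, and \<open>x\<close> alone would improve \<open>A\<close>.\<close>

lemma triple_meets_triple:
  assumes "x \<in> V" "card (U x) = 3"
  obtains v where "v \<in> A" "card (U v) = 3" "U x \<inter> U v \<noteq> {}"
proof (cases "x \<in> A")
  case True
  moreover have "U x \<inter> U x \<noteq> {}"
    using assms(2) by auto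
  ultimately show ?thesis
    by (intro that[of x]) (simp_all add: assms(2))
next
  case False
  let ?N = "A \<inter> neighbours G {x}"
  have N: "?N \<subseteq> V" "\<And>v. v \<in> ?N \<Longrightarrow> U x \<inter> U v \<noteq> {}"
    by (auto simp: neighbours_def adj_iff)
  show ?thesis
  proof (cases "\<exists>v\<in>?N. card (U v) = 3")
    case True
    then obtain v where "v \<in> ?N" "card (U v) = 3" by blast
    with N(2)[of v] show ?thesis by (intro that[of v]) simp_all
  next
    case False
    have "w v = 1" if "v \<in> ?N" for v
      using weight_cases[of v] False N(1) that by blast
    then have "weight2 w ?N = card ?N"
      by (simp add: weight2_def)
    moreover have "card ?N \<le> 3"
    proof (rule claw_card_le_3)
      show "is_claw G (card ?N) (Some x) ?N"
        using indep_A assms(1) finite_subset[OF N(1) finite_V]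
        by (auto simp: is_claw_def independent_set_def neighbours_def)
    qed
    ultimately have "(w x)\<^sup>2 \<le> 3"
      using single_claw_weight2_le[OF assms(1) \<open>x \<notin> A\<close>] by simp
    moreover have "w x = 2" using assms by (simp add: intersection_weight_def)
    ultimately show ?thesis by simp
  qed
qed

section \<open>Double counting by shares against an independent set\<close>

context
  fixes B
  assumes indep_B: "independent_set G B"
begin

definition heavy :: "'a set" where
  "heavy = {e \<in> covered. (\<exists>v\<in>A. card (U v) = 3 \<and> e \<in> U v) \<or> (\<exists>u\<in>B. e \<in> U u \<and> \<not> U u \<subseteq> covered)}"

definition share :: "'a \<Rightarrow> nat" where
  "share e = (if e \<in> heavy then 2 else 1)"

lemma B_subset: "B \<subseteq> V"
  using indep_B by (simp add: independent_set_def)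

lemma in_A_unique: "e \<in> U v \<Longrightarrow> v \<in> A \<Longrightarrow> e \<in> U v' \<Longrightarrow> v' \<in> A \<Longrightarrow> v' = v"
  using independent_disjoint[OF indep_A] by blast

text \<open>If both elements of a pair in \<open>A\<close> were heavy, then two pairs of the collection, each
  consisting of one of them and an uncovered element, would form an improving claw.\<close>

lemma pair_not_heavy:
  assumes v: "v \<in> A" "U v = {a, b}" "a \<noteq> b"
  shows "\<not> (a \<in> heavy \<and> b \<in> heavy)"
proof
  assume "a \<in> heavy \<and> b \<in> heavy"
  \<comment> \<open>By disjointness the elements of \<open>v\<close> lie in no triple of
    \<open>A\<close>, so both can be heavy only because of sets of \<open>B\<close> with an
    uncovered element.\<close>
  moreover have "card (U v') = 2" if "e \<in> U v" "v' \<in> A" "e \<in> U v'" for e v'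
    using in_A_unique[OF that(1) v(1) that(3,2)] v by simp
  then have "\<not> (\<exists>v'\<in>A. card (U v') = 3 \<and> a \<in> U v')" "\<not> (\<exists>v'\<in>A. card (U v') = 3 \<and> b \<in> U v')"
    using v by force+
  ultimately obtain x y where x: "x \<in> B" "a \<in> U x" "\<not> U x \<subseteq> covered"
    and y: "y \<in> B" "b \<in> U y" "\<not> U y \<subseteq> covered"
    unfolding heavy_def by blast
  then obtain c d where c: "c \<in> U x" "c \<notin> covered" and d: "d \<in> U y" "d \<notin> covered"
    by blast
  have ab: "a \<in> covered" "b \<in> covered" using v by (auto simp: covered_def)
  have "x \<in> V" "y \<in> V" using B_subset x y by auto
  show False
  proof (cases "x = y")
    \<comment> \<open>A single set of \<open>B\<close> containing \<open>a\<close>, \<open>b\<close>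
      and the uncovered \<open>c\<close> would be a triple. The triple of \<open>A\<close> that it
      meets would contain \<open>a\<close> or \<open>b\<close> and so be the pair
      \<open>v\<close>.\<close>
    case True
    have "a \<noteq> c" "b \<noteq> c" using c ab by auto
    then have "{a, b, c} \<subseteq> U x" "card {a, b, c} = 3" "card (U x) \<le> 3"
      using x y c v(3) True card_U[OF \<open>x \<in> V\<close>] by auto
    then have "U x = {a, b, c}" "card (U x) = 3"
      using finite_U[OF \<open>x \<in> V\<close>] by (metis card_seteq)+
    with triple_meets_triple[OF \<open>x \<in> V\<close>] obtain v' where "v' \<in> A" "card (U v') = 3" "U x \<inter> U v' \<noteq> {}"
      by metis
    moreover have "c \<notin> U v'" using c \<open>v' \<in> A\<close> by (auto simp: covered_def)
    ultimately have "v' = v"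
      using in_A_unique[of _ v v'] v \<open>U x = {a, b, c}\<close> by blast
    then show False using v \<open>card (U v') = 3\<close> by simp
  next
    case False
    then have disj: "U x \<inter> U y = {}"
      using independent_disjoint indep_B x y by blast
    have ac: "a \<noteq> c" and bd: "b \<noteq> d" using c d ab by auto
    obtain x' where x': "x' \<in> V" "U x' = {a, c}"
      using exists_pair[OF \<open>x \<in> V\<close> x(2) c(1) ac] .
    obtain y' where y': "y' \<in> V" "U y' = {b, d}"
      using exists_pair[OF \<open>y \<in> V\<close> y(2) d(1) bd] .
    let ?T = "{x', y'}"
    have "U x' \<subseteq> U x" "U y' \<subseteq> U y"
      unfolding x'(2) y'(2) using x(2) y(2) c(1) d(1) by simp_all
    then have "U x' \<inter> U y' = {}" using disj by blast
    then have ne: "x' \<noteq> y'" using x' by auto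
    have T_A: "?T \<inter> A = {}"
      using x' y' c d by (auto simp: covered_def)
    have "is_claw G 2 (Some v) ?T"
      using \<open>U x' \<inter> U y' = {}\<close> ne x' y' v A_subset T_A
      by (auto simp: is_claw_def independent_set_def adj_iff)
    then have "weight2 w ?T \<le> weight2 w (A \<inter> neighbours G ?T)"
      using T_A by (rule claw_weight2_le)
    \<comment> \<open>\<open>c\<close> and \<open>d\<close> are uncovered, and \<open>a\<close> and
      \<open>b\<close> lie in no set of \<open>A\<close> but that of \<open>v\<close>. So the
      exchange gives up at most \<open>v\<close>: squared weight 2 against 1.\<close>
    moreover have "A \<inter> neighbours G ?T \<subseteq> {v}"
    proof
      fix v' assume "v' \<in> A \<inter> neighbours G ?T"
      then have "v' \<in> A" "U v' \<inter> {a, b, c, d} \<noteq> {}"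
        using x' y' by (auto simp: neighbours_def adj_iff)
      moreover have "c \<notin> U v'" "d \<notin> U v'"
        using c d \<open>v' \<in> A\<close> by (auto simp: covered_def)
      ultimately show "v' \<in> {v}"
        using in_A_unique[of _ v v'] v by blast
    qed
    then have "weight2 w (A \<inter> neighbours G ?T) \<le> weight2 w {v}"
      unfolding weight2_def by (intro sum_mono2) auto
    moreover have "w x' = 1" "w y' = 1" "w v = 1"
      using x' y' v ac bd by (simp_all add: intersection_weight_def)
    ultimately show False using ne by (simp add: weight2_def)
  qed
qed

text \<open>A pair has at most one heavy element, giving at most 2 + 1 = 3; a triple has at most 2 *
  3 = 6.\<close>

lemma share_sum_A:
  assumes "v \<in> A"
  shows "(\<Sum>e\<in>U v. share e) \<le> 3 * w v"
proof (cases "card (U v) = 2")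
  case True
  then obtain a b where ab: "U v = {a, b}" "a \<noteq> b" by (auto simp: card_2_iff)
  then have "w v = 1" by (simp add: intersection_weight_def)
  with pair_not_heavy[OF assms ab] ab show ?thesis by (simp add: share_def)
next
  case False
  then have "card (U v) = 3" "w v = 2"
    using weight_cases A_subset assms by blast+
  moreover have "(\<Sum>e\<in>U v. share e) \<le> (\<Sum>e\<in>U v. 2)"
    by (intro sum_mono) (simp add: share_def)
  ultimately show ?thesis by simp
qed

text \<open>A covered pair receives at least 1 + 1, a covered triple at least 2 + 1 + 1 because it
  meets a triple of \<open>A\<close>. Otherwise only one element is uncovered and all others have
  share 2.\<close>

lemma share_sum_B:
  assumes "u \<in> B"
  shows "2 * w u \<le> (\<Sum>e\<in>U u \<inter> covered. share e)"
proof (cases "U u \<subseteq> covered")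
  case True
  have u: "u \<in> V" using assms B_subset by blast
  have 1: "card (U u) \<le> (\<Sum>e\<in>U u. share e)"
    unfolding card_eq_sum by (intro sum_mono) (simp add: share_def)
  from weight_cases[OF u] show ?thesis
  proof
    assume "w u = 1 \<and> card (U u) = 2"
    with 1 True show ?thesis by (simp add: Int_absorb2)
  next
    assume u3: "w u = 2 \<and> card (U u) = 3"
    then obtain v e where "v \<in> A" "card (U v) = 3" "e \<in> U u" "e \<in> U v"
      using triple_meets_triple[OF u] by blast
    then have e: "e \<in> U u" "share e = 2"
      using True by (auto simp: share_def heavy_def)
    have "card (U u - {e}) \<le> (\<Sum>e\<in>U u - {e}. share e)"
      unfolding card_eq_sum by (intro sum_mono) (simp add: share_def)
    with e u3 finite_U[OF u] have "4 \<le> (\<Sum>e\<in>U u. share e)"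
      by (simp add: sum.remove[of _ e])
    with True u3 show ?thesis by (simp add: Int_absorb2)
  qed
next
  case False
  have u: "u \<in> V" using assms B_subset by blast
  have "(\<Sum>e\<in>U u \<inter> covered. share e) = (\<Sum>e\<in>U u \<inter> covered. 2)"
    using False assms by (intro sum.cong) (auto simp: share_def heavy_def)
  also have "\<dots> = 2 * card (U u \<inter> covered)" by simp
  also have "card (U u \<inter> covered) = card (U u) - card (U u - covered)"
    using finite_U[OF u] card_Int_Diff[of "U u" covered] by simp
  finally show ?thesis
    using card_uncovered[OF u] by (simp add: intersection_weight_def)
qed

lemma local_opt_weight: "2 * weight w B \<le> 3 * weight w A"
proof -
  have "2 * weight w B \<le> (\<Sum>u\<in>B. \<Sum>e\<in>U u \<inter> covered. share e)"
    unfolding weight_def sum_distrib_left by (intro sum_mono share_sum_B)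
  \<comment> \<open>Extending the share by 0 outside \<open>covered\<close> allows summation over
    the whole sets, which are disjoint.\<close>
  also have "\<dots> = (\<Sum>u\<in>B. \<Sum>e\<in>U u. if e \<in> covered then share e else 0)"
    using B_subset finite_U by (intro sum.cong[OF refl], subst sum.inter_restrict) auto
  also have "\<dots> = (\<Sum>e\<in>(\<Union>u\<in>B. U u). if e \<in> covered then share e else 0)"
    by (rule independent_sum_Union[OF indep_B])
  also have "\<dots> \<le> (\<Sum>e\<in>covered. share e)"
  proof -
    have "finite (\<Union>u\<in>S. U u)" if "S \<subseteq> V" for S
      using finite_subset[OF that finite_V] finite_U that by (intro finite_UN_I) blast+
    then have "finite (\<Union>u\<in>B. U u)" "finite covered"
      unfolding covered_def using B_subset A_subset by blast+
    then show ?thesis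
      by (subst sum.inter_restrict[symmetric]) (auto intro: sum_mono2)
  qed
  also have "\<dots> = (\<Sum>v\<in>A. \<Sum>e\<in>U v. share e)"
    unfolding covered_def by (rule independent_sum_Union[OF indep_A, symmetric])
  also have "\<dots> \<le> 3 * weight w A"
    unfolding weight_def sum_distrib_left by (intro sum_mono share_sum_A)
  finally show ?thesis .
qed

end

end

theorem squareimp_approximation:
  assumes "squareimp_returns G w A" "independent_set G B"
  shows "independent_set G A \<and> 2 * weight w B \<le> 3 * weight w A"
proof -
  have "independent_set G A"
    using assms(1) squareimp_steps_independent independent_empty
    by (auto simp: squareimp_returns_def)
  moreover have "2 * weight w B \<le> 3 * weight w A"
    using assms calculation by (intro local_opt_weight) (auto simp: squareimp_returns_def)
  ultimately show ?thesis ..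
qed

end

section \<open>Loop programs and their compilation\<close>

text \<open>A loop program repeats its loop bodies \<open>n\<close> times, where \<open>n\<close> is the content of register 0,
  which is never written. Hence its running time is a polynomial in \<open>n\<close> that can be read off from
  the program.\<close>

datatype exp = Const nat | Var nat | Plus exp exp | Minus exp exp | Mem exp

datatype com =
    Assign nat exp
  | Put exp exp
  | Then com com  (infixr ";;" 60)
  | When exp com
  | For nat com

section \<open>Semantics of loop programs\<close>

primrec aval :: "exp \<Rightarrow> ram_state \<Rightarrow> nat" where
  "aval (Const c) s = c"
| "aval (Var x) s = fst s x"
| "aval (Plus a b) s = aval a s + aval b s"
| "aval (Minus a b) s = aval a s - aval b s"
| "aval (Mem a) s = snd s (aval a s)"

text \<open>Indices run from \<open>n - 1\<close> down to 0, so that the counter of the compiled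
  loop, once decremented, is the loop index itself.\<close>

primrec countdown :: "nat \<Rightarrow> (nat \<Rightarrow> 's \<Rightarrow> 's) \<Rightarrow> 's \<Rightarrow> 's" where
  "countdown 0 f s = s"
| "countdown (Suc k) f s = countdown k f (f k s)"

text \<open>\<open>I k\<close> is to describe the state once the indices from \<open>k\<close> on
  have been processed.\<close>

lemma countdown_invariant:
  assumes "I n s" "\<And>k s. k < n \<Longrightarrow> I (Suc k) s \<Longrightarrow> I k (f k s)"
  shows "I 0 (countdown n f s)"
  using assms by (induction n arbitrary: s) auto

primrec sem :: "com \<Rightarrow> ram_state \<Rightarrow> ram_state" where
  "sem (Assign x e) s = ((fst s)(x := aval e s), snd s)"
| "sem (Put a e) s = (fst s, (snd s)(aval a s := aval e s))"
| "sem (c ;; d) s = sem d (sem c s)"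
| "sem (When e c) s = (if aval e s \<noteq> 0 then sem c s else s)"
| "sem (For x c) s = countdown (fst s 0) (\<lambda>k s. sem c ((fst s)(x := k), snd s)) s"

primrec evars :: "exp \<Rightarrow> nat set" where
  "evars (Const c) = {}"
| "evars (Var x) = {x}"
| "evars (Plus a b) = evars a \<union> evars b"
| "evars (Minus a b) = evars a \<union> evars b"
| "evars (Mem a) = evars a"

primrec writes :: "com \<Rightarrow> nat set" where
  "writes (Assign x e) = {x}"
| "writes (Put a e) = {}"
| "writes (c ;; d) = writes c \<union> writes d"
| "writes (When e c) = writes c"
| "writes (For x c) = insert x (writes c)"

primrec vars :: "com \<Rightarrow> nat set" where
  "vars (Assign x e) = insert x (evars e)"
| "vars (Put a e) = evars a \<union> evars e"
| "vars (c ;; d) = vars c \<union> vars d"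
| "vars (When e c) = evars e \<union> vars c"
| "vars (For x c) = insert 0 (insert x (vars c))"

lemma sem_frame: "x \<notin> writes c \<Longrightarrow> fst (sem c s) x = fst s x"
proof (induction c arbitrary: s)
  case (For y c)
  then show ?case
    using countdown_invariant[where I = "\<lambda>_ t. fst t x = fst s x" and n = "fst s 0" and s = s
        and f = "\<lambda>k s. sem c ((fst s)(y := k), snd s)"] by simp
qed auto

text \<open>Compiled code keeps its temporary values in the registers from \<open>d\<close> on.\<close>

definition copy :: "nat \<Rightarrow> nat \<Rightarrow> ram" where
  "copy x y = Seq (SetC x 0) (AddR x x y)"

primrec compile_exp :: "exp \<Rightarrow> nat \<Rightarrow> ram" where
  "compile_exp (Const c) d = SetC d c"
| "compile_exp (Var x) d = copy d x"
| "compile_exp (Plus a b) d =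
     Seq (compile_exp a d) (Seq (compile_exp b (Suc d)) (AddR d d (Suc d)))"
| "compile_exp (Minus a b) d =
     Seq (compile_exp a d) (Seq (compile_exp b (Suc d)) (SubR d d (Suc d)))"
| "compile_exp (Mem a) d = Seq (compile_exp a d) (Load d d)"

text \<open>In a loop, register \<open>d\<close> holds the number of remaining rounds, so the body
  is compiled with \<open>Suc d\<close> and leaves the counter alone.\<close>

primrec compile :: "com \<Rightarrow> nat \<Rightarrow> ram" where
  "compile (Assign x e) d = Seq (compile_exp e d) (copy x d)"
| "compile (Put a e) d = Seq (compile_exp a d) (Seq (compile_exp e (Suc d)) (Store d (Suc d)))"
| "compile (b ;; c) d = Seq (compile b d) (compile c d)"
| "compile (When e c) d = Seq (compile_exp e d) (IfNZ d (compile c d) Skip)"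
| "compile (For x c) d =
     Seq (copy d 0)
       (WhileNZ d
         (Seq (Seq (Seq (SetC (Suc d) 1) (SubR d d (Suc d))) (copy x d)) (compile c (Suc d))))"

primrec cost_exp :: "exp \<Rightarrow> nat" where
  "cost_exp (Const c) = 1"
| "cost_exp (Var x) = 2"
| "cost_exp (Plus a b) = cost_exp a + cost_exp b + 1"
| "cost_exp (Minus a b) = cost_exp a + cost_exp b + 1"
| "cost_exp (Mem a) = cost_exp a + 1"

text \<open>In \<open>When\<close>, 2 pays for the branch and a possible \<open>Skip\<close>. In
  \<open>For\<close>, 3 pays for copying register 0 and for the final test, 5 for the test, the
  decrement and the copying in each round.\<close>

primrec cost :: "com \<Rightarrow> nat poly" where
  "cost (Assign x e) = [:cost_exp e + 2:]"
| "cost (Put a e) = [:cost_exp a + cost_exp e + 1:]"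
| "cost (c ;; d) = cost c + cost d"
| "cost (When e c) = [:cost_exp e + 2:] + cost c"
| "cost (For x c) = [:3:] + [:0, 1:] * ([:5:] + cost c)"

section \<open>Correctness and running time of compiled programs\<close>

lemma exec_copy: "x \<noteq> y \<Longrightarrow> exec (copy x y) (r, m) 2 (r(x := r y), m)"
  unfolding copy_def using exec.Seq[OF exec.SetC[of x 0 r m] exec.AddR[of x x y "r(x := 0)" m]]
  by (simp add: numeral_2_eq_2)

lemma val_cong: "(\<And>x. x \<in> evars e \<Longrightarrow> r x = r' x) \<Longrightarrow> aval e (r, m) = aval e (r', m)"
  by (induction e) auto

text \<open>Preserving the registers below \<open>d\<close> makes the induction work: the second
  operand is evaluated from \<open>Suc d\<close> on and cannot destroy the first result in
  \<open>d\<close>.\<close>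

lemma exec_compile_exp:
  "evars e \<subseteq> {..<d} \<Longrightarrow>
   \<exists>r'. exec (compile_exp e d) (r, m) (cost_exp e) (r', m) \<and> r' d = aval e (r, m) \<and> (\<forall>x<d. r' x = r x)"
proof (induction e arbitrary: d r)
  case (Const c)
  show ?case using exec.SetC[of d c r m] by (auto intro!: exI)
next
  case (Var x)
  then show ?case using exec_copy[of d x r m] by (auto intro!: exI)
next
  case (Plus a b)
  obtain r1 where 1: "exec (compile_exp a d) (r, m) (cost_exp a) (r1, m)" "r1 d = aval a (r, m)"
      "\<forall>x<d. r1 x = r x"
    using Plus.IH(1)[of d r] Plus.prems by auto
  obtain r2 where 2: "exec (compile_exp b (Suc d)) (r1, m) (cost_exp b) (r2, m)"
      "r2 (Suc d) = aval b (r1, m)" "\<forall>x<Suc d. r2 x = r1 x"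
    using Plus.IH(2)[of "Suc d" r1] Plus.prems by (auto simp: subset_iff less_Suc_eq)
  have "aval b (r1, m) = aval b (r, m)"
    using 1 Plus.prems by (intro val_cong) auto
  then have v: "aval (Plus a b) (r, m) = r2 d + r2 (Suc d)"
    using 1 2 by simp
  let ?r = "r2(d := r2 d + r2 (Suc d))"
  have "exec (compile_exp (Plus a b) d) (r, m) (cost_exp (Plus a b)) (?r, m)"
    using exec.Seq[OF 1(1) exec.Seq[OF 2(1) exec.AddR[of d d "Suc d"]]] by simp
  moreover have "?r d = aval (Plus a b) (r, m)" "\<forall>x<d. ?r x = r x"
    unfolding v using 1 2 by simp_all
  ultimately show ?case by blast
next
  case (Minus a b)
  obtain r1 where 1: "exec (compile_exp a d) (r, m) (cost_exp a) (r1, m)" "r1 d = aval a (r, m)"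
      "\<forall>x<d. r1 x = r x"
    using Minus.IH(1)[of d r] Minus.prems by auto
  obtain r2 where 2: "exec (compile_exp b (Suc d)) (r1, m) (cost_exp b) (r2, m)"
      "r2 (Suc d) = aval b (r1, m)" "\<forall>x<Suc d. r2 x = r1 x"
    using Minus.IH(2)[of "Suc d" r1] Minus.prems by (auto simp: subset_iff less_Suc_eq)
  have "aval b (r1, m) = aval b (r, m)"
    using 1 Minus.prems by (intro val_cong) auto
  then have v: "aval (Minus a b) (r, m) = r2 d - r2 (Suc d)"
    using 1 2 by simp
  let ?r = "r2(d := r2 d - r2 (Suc d))"
  have "exec (compile_exp (Minus a b) d) (r, m) (cost_exp (Minus a b)) (?r, m)"
    using exec.Seq[OF 1(1) exec.Seq[OF 2(1) exec.SubR[of d d "Suc d"]]] by simp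
  moreover have "?r d = aval (Minus a b) (r, m)" "\<forall>x<d. ?r x = r x"
    unfolding v using 1 2 by simp_all
  ultimately show ?case by blast
next
  case (Mem a)
  obtain r1 where 1: "exec (compile_exp a d) (r, m) (cost_exp a) (r1, m)" "r1 d = aval a (r, m)"
      "\<forall>x<d. r1 x = r x"
    using Mem.IH[of d r] Mem.prems by auto
  let ?r = "r1(d := m (r1 d))"
  have "exec (compile_exp (Mem a) d) (r, m) (cost_exp (Mem a)) (?r, m)"
    using exec.Seq[OF 1(1) exec.Load[of d d]] by simp
  moreover have "?r d = aval (Mem a) (r, m)" "\<forall>x<d. ?r x = r x"
    using 1 by simp_all
  ultimately show ?case by blast
qed

text \<open>Compiled code leaves arbitrary values in its temporary registers, so it can match
  \<open>sem\<close> only in the memory and below \<open>d\<close>.\<close>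

definition agree :: "nat \<Rightarrow> ram_state \<Rightarrow> ram_state \<Rightarrow> bool" where
  "agree d s s' \<longleftrightarrow> snd s = snd s' \<and> (\<forall>x<d. fst s x = fst s' x)"

lemma agree_trans: "agree d s s' \<Longrightarrow> agree d s' s'' \<Longrightarrow> agree d s s''"
  by (simp add: agree_def)

lemma agree_mono: "agree d' s s' \<Longrightarrow> d \<le> d' \<Longrightarrow> agree d s s'"
  by (simp add: agree_def)

lemma agree_val: "agree d s s' \<Longrightarrow> evars e \<subseteq> {..<d} \<Longrightarrow> aval e s = aval e s'"
  using val_cong[of e "fst s" "fst s'" "snd s"] by (cases s, cases s') (auto simp: agree_def)

lemma agree_countdown:
  assumes "agree d s s'" "\<And>k s s'. agree d s s' \<Longrightarrow> agree d (f k s) (f k s')"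
  shows "agree d (countdown n f s) (countdown n f s')"
  using assms by (induction n arbitrary: s s') auto

text \<open>A program that mentions only registers below \<open>d\<close> cannot notice the
  temporary values left by the code before it.\<close>

lemma agree_sem: "vars c \<subseteq> {..<d} \<Longrightarrow> agree d s s' \<Longrightarrow> agree d (sem c s) (sem c s')"
proof (induction c arbitrary: s s')
  case (For x c)
  have "fst s 0 = fst s' 0" using For.prems by (auto simp: agree_def)
  then show ?case
    using For.prems by (auto intro!: agree_countdown For.IH) (simp add: agree_def)
next
  case (Assign x e)
  then show ?case using agree_val[of d s s' e] by (auto simp: agree_def)
next
  case (Put a e)
  then show ?case
    using agree_val[of d s s' e] agree_val[of d s s' a] by (auto simp: agree_def)
next
  case (When e c)
  then show ?case using agree_val[of d s s' e] by auto
qed auto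

text \<open>Register 0 is never written, so it bounds every nested loop by its initial value, at
  which the cost polynomial is evaluated.\<close>

lemma exec_compile:
  "vars c \<subseteq> {..<d} \<Longrightarrow> 0 \<notin> writes c \<Longrightarrow> 0 < d \<Longrightarrow>
   \<exists>t s'. exec (compile c d) s t s' \<and> t \<le> poly (cost c) (fst s 0) \<and> agree d s' (sem c s)"
proof (induction c arbitrary: d s)
  case (Assign x e)
  obtain r m where s: "s = (r, m)" by (cases s)
  obtain r1 where 1: "exec (compile_exp e d) (r, m) (cost_exp e) (r1, m)" "r1 d = aval e (r, m)"
      "\<forall>x<d. r1 x = r x"
    using exec_compile_exp[of e d r m] Assign.prems by auto
  show ?case
    using exec.Seq[OF 1(1) exec_copy[of x d r1 m]] Assign.prems 1 s
    by (auto intro!: exI simp: agree_def)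
next
  case (Put a e)
  obtain r m where s: "s = (r, m)" by (cases s)
  obtain r1 where 1: "exec (compile_exp a d) (r, m) (cost_exp a) (r1, m)" "r1 d = aval a (r, m)"
      "\<forall>x<d. r1 x = r x"
    using exec_compile_exp[of a d r m] Put.prems by auto
  have "evars e \<subseteq> {..<Suc d}" using Put.prems by auto
  then obtain r2 where 2: "exec (compile_exp e (Suc d)) (r1, m) (cost_exp e) (r2, m)"
      "r2 (Suc d) = aval e (r1, m)" "\<forall>x<Suc d. r2 x = r1 x"
    using exec_compile_exp by blast
  have "aval e (r1, m) = aval e (r, m)"
    using 1 Put.prems by (intro val_cong) auto
  then show ?case
    using exec.Seq[OF 1(1) exec.Seq[OF 2(1) exec.Store[of d "Suc d"]]] 1 2 s
    by (auto intro!: exI simp: agree_def)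
next
  case (Then b c)
  obtain t1 s1 where 1: "exec (compile b d) s t1 s1" "t1 \<le> poly (cost b) (fst s 0)"
      "agree d s1 (sem b s)"
    using Then.IH(1)[of d s] Then.prems by auto
  obtain t2 s2 where 2: "exec (compile c d) s1 t2 s2" "t2 \<le> poly (cost c) (fst s1 0)"
      "agree d s2 (sem c s1)"
    using Then.IH(2)[of d s1] Then.prems by auto
  have "fst s1 0 = fst s 0"
    using 1(3) Then.prems sem_frame[of 0 b s] by (simp add: agree_def)
  moreover have "agree d s2 (sem c (sem b s))"
    using 2(3) agree_sem[OF _ 1(3), of c] Then.prems by (auto intro: agree_trans)
  ultimately show ?case
    using exec.Seq[OF 1(1) 2(1)] 1(2) 2(2) by fastforce
next
  case (When e c)
  obtain r m where s: "s = (r, m)" by (cases s)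
  obtain r1 where 1: "exec (compile_exp e d) (r, m) (cost_exp e) (r1, m)" "r1 d = aval e (r, m)"
      "\<forall>x<d. r1 x = r x"
    using exec_compile_exp[of e d r m] When.prems by auto
  have ag: "agree d (r1, m) s" using 1 s by (simp add: agree_def)
  show ?case
  proof (cases "aval e s = 0")
    case True
    then have "exec (IfNZ d (compile c d) Skip) (r1, m) (1 + 1) (r1, m)"
      using 1 s by (intro exec.IfFalse exec.Skip) simp
    from exec.Seq[OF 1(1) this] show ?thesis
      using True ag s by (intro exI[of _ "cost_exp e + (1 + 1)"] exI[of _ "(r1, m)"]) simp
  next
    case False
    obtain t2 s2 where 2: "exec (compile c d) (r1, m) t2 s2" "t2 \<le> poly (cost c) (r1 0)"
        "agree d s2 (sem c (r1, m))"
      using When.IH[of d "(r1, m)"] When.prems by auto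
    have "exec (IfNZ d (compile c d) Skip) (r1, m) (1 + t2) s2"
      using 1 s False by (intro exec.IfTrue 2) simp
    moreover have "agree d s2 (sem c s)"
      using 2(3) agree_sem[OF _ ag, of c] When.prems by (auto intro: agree_trans)
    ultimately show ?thesis
      using exec.Seq[OF 1(1), of "IfNZ d (compile c d) Skip" "1 + t2" s2] False 1(3) 2(2) When.prems s
      by (intro exI[of _ "cost_exp e + (1 + t2)"] exI[of _ s2]) simp
  qed
next
  case (For x c)
  let ?body = "Seq (Seq (Seq (SetC (Suc d) 1) (SubR d d (Suc d))) (copy x d)) (compile c (Suc d))"
  let ?f = "\<lambda>k s. sem c ((fst s)(x := k), snd s)"
  have x: "x < d" "x \<noteq> 0" and c: "vars c \<subseteq> {..<d}" "0 \<notin> writes c"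
    using For.prems by auto
  then have c': "vars c \<subseteq> {..<Suc d}" by auto
  then have d_c: "d \<notin> writes c"
  proof -
    have "writes c \<subseteq> vars c" by (induction c) auto
    with c show ?thesis by auto
  qed
  have loop: "\<exists>t s'. exec (WhileNZ d ?body) s t s' \<and> t \<le> 1 + k * (5 + poly (cost c) (fst s 0)) \<and>
      agree d s' (countdown k ?f s)" if "fst s d = k" for k s
    using that
  proof (induction k arbitrary: s)
    case 0
    then show ?case using exec.WhileFalse[of s d] by (intro exI[of _ 1] exI[of _ s]) (simp add: agree_def)
  next
    case (Suc k)
    obtain r m where s: "s = (r, m)" by (cases s)
    let ?r = "r(Suc d := 1, d := k, x := k)"
    have "exec (Seq (Seq (SetC (Suc d) 1) (SubR d d (Suc d))) (copy x d)) (r, m) (1 + 1 + 2) (?r, m)"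
    proof (intro exec.Seq)
      show "exec (SetC (Suc d) 1) (r, m) 1 (r(Suc d := 1), m)" by (rule exec.SetC)
      show "exec (SubR d d (Suc d)) (r(Suc d := 1), m) 1 (r(Suc d := 1, d := k), m)"
        using exec.SubR[of d d "Suc d" "r(Suc d := 1)" m] Suc.prems s by simp
      show "exec (copy x d) (r(Suc d := 1, d := k), m) 2 (?r, m)"
        using exec_copy[of x d "r(Suc d := 1, d := k)" m] x by simp
    qed
    note prep = this
    obtain t1 s1 where 1: "exec (compile c (Suc d)) (?r, m) t1 s1"
        "t1 \<le> poly (cost c) (?r 0)" "agree (Suc d) s1 (sem c (?r, m))"
      using For.IH[of "Suc d" "(?r, m)"] c' c by auto
    have body: "exec ?body s (4 + t1) s1"
      using exec.Seq[OF prep 1(1)] s by (simp add: eval_nat_numeral)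
    \<comment> \<open>The body writes neither 0 nor \<open>d\<close> and keeps its temporary values
      above \<open>d\<close>, so the bound and the counter survive.\<close>
    have s1: "fst s1 d = k" "fst s1 0 = fst s 0"
      using 1(3) sem_frame[OF d_c, of "(?r, m)"] sem_frame[OF c(2), of "(?r, m)"] x s For.prems(3)
      by (auto simp: agree_def)
    obtain t2 s2 where 2: "exec (WhileNZ d ?body) s1 t2 s2"
        "t2 \<le> 1 + k * (5 + poly (cost c) (fst s1 0))" "agree d s2 (countdown k ?f s1)"
      using Suc.IH[OF s1(1)] by blast
    \<comment> \<open>The semantics sets only \<open>x\<close>, whereas the machine has also changed
      \<open>d\<close> and \<open>Suc d\<close>; the registers below \<open>d\<close> do not show
      the difference.\<close>
    have "agree d s1 (?f k s)"
    proof (rule agree_trans)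
      show "agree d s1 (sem c (?r, m))" using 1(3) by (rule agree_mono) simp
      show "agree d (sem c (?r, m)) (?f k s)"
        using c s x by (intro agree_sem) (auto simp: agree_def)
    qed
    then have "agree d (countdown k ?f s1) (countdown k ?f (?f k s))"
      using c x by (intro agree_countdown) (auto intro!: agree_sem, auto simp: agree_def)
    with 2(3) have "agree d s2 (countdown (Suc k) ?f s)"
      by (auto intro: agree_trans)
    moreover have "exec (WhileNZ d ?body) s (1 + (4 + t1) + t2) s2"
      using body 2(1) Suc.prems by (intro exec.WhileTrue) auto
    moreover have "1 + (4 + t1) + t2 \<le> 1 + Suc k * (5 + poly (cost c) (fst s 0))"
      using 1(2) 2(2) s1 s x For.prems(3) by simp
    ultimately show ?case by blast
  qed
  obtain r m where s: "s = (r, m)" by (cases s)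
  let ?s = "(r(d := r 0), m)"
  have d0: "0 \<noteq> d" using For.prems(3) by simp
  have cp: "exec (copy d 0) s 2 ?s"
    using exec_copy For.prems(3) s by auto
  obtain t s' where l: "exec (WhileNZ d ?body) ?s t s'"
      "t \<le> 1 + r 0 * (5 + poly (cost c) (r 0))" "agree d s' (countdown (r 0) ?f ?s)"
    using loop[of ?s "r 0"] For.prems(3) unfolding fst_conv fun_upd_same fun_upd_other[OF d0] by blast
  have "agree d (countdown (r 0) ?f ?s) (countdown (r 0) ?f s)"
    using c s by (intro agree_countdown) (auto intro!: agree_sem, auto simp: agree_def)
  then have "agree d s' (sem (For x c) s)"
    using l(3) s by (auto intro: agree_trans)
  moreover have "exec (compile (For x c) d) s (2 + t) s'"
    using exec.Seq[OF cp l(1)] by simp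
  moreover have "2 + t \<le> poly (cost (For x c)) (fst s 0)"
    using l(2) s by simp
  ultimately show ?case by blast
qed

section \<open>The program\<close>

text \<open>Expressions serve as truth values, every nonzero value being true.\<close>

abbreviation Neg :: "exp \<Rightarrow> exp" where
  "Neg e \<equiv> Minus (Const 1) e"

abbreviation Disj :: "exp \<Rightarrow> exp \<Rightarrow> exp" where
  "Disj \<equiv> Plus"

text \<open>De Morgan's law: by truncation \<open>Neg\<close> is 1 on 0 and 0 elsewhere, and a sum
  of naturals is nonzero iff a summand is.\<close>

definition Conj :: "exp \<Rightarrow> exp \<Rightarrow> exp" where
  "Conj a b = Neg (Disj (Neg a) (Neg b))"

lemma aval_Conj [simp]: "0 < aval (Conj a b) s \<longleftrightarrow> 0 < aval a s \<and> 0 < aval b s"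
  by (auto simp: Conj_def)

lemma evars_Conj [simp]: "evars (Conj a b) = evars a \<union> evars b"
  by (simp add: Conj_def)

definition Same :: "nat \<Rightarrow> nat \<Rightarrow> exp" where
  "Same x y = Neg (Disj (Minus (Var x) (Var y)) (Minus (Var y) (Var x)))"

lemma aval_Same [simp]: "0 < aval (Same x y) s \<longleftrightarrow> fst s x = fst s y"
  by (auto simp: Same_def)

lemma evars_Same [simp]: "evars (Same x y) = {x, y}"
  by (auto simp: Same_def)

text \<open>The registers 1, 2 and 3 hold the addresses of the weights, of the marks of the current set
  and of a table of the multiples of \<open>n\<close>, which replaces the missing multiplication. The registers
  4 to 7 hold the numbers of the center and of the (at most three) talons of a claw.\<close>

definition Edge :: "nat \<Rightarrow> nat \<Rightarrow> exp" where
  "Edge x y = Mem (Plus (Mem (Plus (Var 3) (Var x))) (Var y))"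

definition Marked :: "nat \<Rightarrow> exp" where
  "Marked x = Mem (Plus (Var 2) (Var x))"

text \<open>Weights are 1 or 2, so that \<open>3 * w - 2\<close> is the square of \<open>w\<close>.\<close>

definition Square_weight :: "nat \<Rightarrow> exp" where
  "Square_weight x =
     (let w = Mem (Plus (Var 1) (Var x)) in Minus (Plus w (Plus w w)) (Const 2))"

text \<open>Talons may repeat or coincide with the center, as in
  \<open>improving_claw_triple\<close>. The graph has no loops, so repetitions pass the tests of
  non-adjacency.\<close>

definition Claw :: exp where
  "Claw =
     Conj (Neg (Disj (Edge 5 6) (Disj (Edge 5 7) (Edge 6 7))))
       (Conj (Disj (Same 5 4) (Edge 4 5)) (Conj (Disj (Same 6 4) (Edge 4 6)) (Disj (Same 7 4) (Edge 4 7))))"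

definition Kept :: exp where
  "Kept =
     Conj (Disj (Marked 8) (Disj (Same 8 5) (Disj (Same 8 6) (Same 8 7))))
       (Neg (Disj (Edge 5 8) (Disj (Edge 6 8) (Edge 7 8))))"

definition compare :: com where
  "compare =
     Assign 9 (Const 0) ;; Assign 10 (Const 0) ;;
     For 8 (When (Marked 8) (Assign 9 (Plus (Var 9) (Square_weight 8))) ;;
            When Kept (Assign 10 (Plus (Var 10) (Square_weight 8))))"

definition update :: com where
  "update = For 8 (Put (Plus (Var 2) (Var 8)) Kept)"

definition try_claw :: com where
  "try_claw = When Claw (compare ;; When (Minus (Var 10) (Var 9)) update)"

definition sweep :: com where
  "sweep = For 4 (For 5 (For 6 (For 7 try_claw)))"

text \<open>Register 1 grows from 0 to \<open>n * n\<close> by repeated addition. Register 9 starts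
  there and loses \<open>n\<close> per round, so that it holds \<open>k * n\<close> when the
  descending index is \<open>k\<close>.\<close>

definition init :: com where
  "init =
     For 4 (Assign 1 (Plus (Var 1) (Var 0))) ;;
     Assign 2 (Plus (Var 1) (Var 0)) ;;
     Assign 3 (Plus (Var 2) (Var 0)) ;;
     Assign 9 (Var 1) ;;
     For 4 (Assign 9 (Minus (Var 9) (Var 0)) ;; Put (Plus (Var 3) (Var 4)) (Var 9))"

text \<open>A sweep either changes the current set and increases its squared weight, which is at most
  \<open>4 * n\<close>, or shows that it is locally optimal. So \<open>4 * n + 1\<close> sweeps suffice.\<close>

definition squareimp_program :: com where
  "squareimp_program = init ;; sweep ;; For 4 (sweep ;; sweep ;; sweep ;; sweep)"

lemmas program_defs =
  squareimp_program_def sweep_def init_def try_claw_def update_def compare_def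
  Kept_def Claw_def Square_weight_def Marked_def Edge_def Let_def

lemma vars_program: "vars squareimp_program \<subseteq> {..<11}"
  by (simp add: program_defs)

lemma writes_program: "0 \<notin> writes squareimp_program"
  by (simp add: program_defs)

lemma writes_try_claw: "writes try_claw = {8, 9, 10}"
  by (auto simp: program_defs)

section \<open>Correctness of the program for a numbering of the vertices\<close>

locale numbered_collection = collection V U for V :: "'v set" and U :: "'v \<Rightarrow> 'a set" +
  fixes n :: nat and f :: "nat \<Rightarrow> 'v"
  assumes numbering: "bij_betw f {..<n} V"
begin

abbreviation "steps \<equiv> (squareimp_step G w)\<^sup>*\<^sup>*"

lemma f_in_V [simp]: "i < n \<Longrightarrow> f i \<in> V"
  using numbering by (auto simp: bij_betw_def)

lemma f_eq_iff [simp]: "i < n \<Longrightarrow> j < n \<Longrightarrow> f i = f j \<longleftrightarrow> i = j"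
  using numbering by (auto simp: bij_betw_def inj_on_def)

lemma obtain_number:
  assumes "v \<in> V"
  obtains i where "i < n" "v = f i"
  using numbering assms by (auto simp: bij_betw_def)

text \<open>Invariant of everything after \<open>init\<close>. Only the marks depend on
  \<open>A\<close>, and the registers from 4 on are left open, so that loop variables and sums may
  change freely.\<close>

definition ready :: "ram_state \<Rightarrow> 'v set \<Rightarrow> bool" where
  "ready s A \<longleftrightarrow>
     fst s 0 = n \<and> fst s 1 = n * n \<and> fst s 2 = n * n + n \<and> fst s 3 = n * n + n + n \<and>
     (\<forall>i<n. \<forall>j<n. snd s (i * n + j) = mult G (f i) (f j)) \<and>
     (\<forall>i<n. snd s (n * n + i) = w (f i)) \<and>
     (\<forall>i<n. snd s (n * n + n + n + i) = i * n) \<and>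
     A = f ` {i. i < n \<and> snd s (n * n + n + i) \<noteq> 0}"

lemma ready_subset: "ready s A \<Longrightarrow> A \<subseteq> V"
  by (auto simp: ready_def)

lemma ready_assign [simp]: "3 < x \<Longrightarrow> ready ((fst s)(x := c), snd s) A \<longleftrightarrow> ready s A"
  by (simp add: ready_def)

lemma ready_assign' [simp]: "3 < x \<Longrightarrow> ready (r(x := c), m) A \<longleftrightarrow> ready (r, m) A"
  by (simp add: ready_def)

lemma row_less: "i < n \<Longrightarrow> j < n \<Longrightarrow> i * n + j < n * n"
proof -
  assume "i < n" "j < n"
  then have "i * n + j < Suc i * n" by simp
  also have "\<dots> \<le> n * n" using \<open>i < n\<close> by (intro mult_le_mono1) simp
  finally show ?thesis .
qed

lemma ready_mark:
  assumes "ready s A" "v < n" "3 < x"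
  shows "ready ((fst s)(x := y), (snd s)(n * n + n + v := c))
    (if c \<noteq> 0 then insert (f v) A else A - {f v})"
proof -
  have "f ` {i. i < n \<and> ((snd s)(n * n + n + v := c)) (n * n + n + i) \<noteq> 0} =
      (if c \<noteq> 0 then insert (f v) A else A - {f v})"
    using assms by (auto simp: ready_def image_iff)
  moreover have "i * n + j \<noteq> n * n + n + v" if "i < n" "j < n" for i j
    using row_less[OF that] by simp
  ultimately show ?thesis
    using assms by (simp add: ready_def)
qed

lemma aval_Edge [simp]:
  assumes "ready s A" "fst s x < n" "fst s y < n"
  shows "0 < aval (Edge x y) s \<longleftrightarrow> adj G (f (fst s x)) (f (fst s y))"
    and "aval (Edge x y) s = 0 \<longleftrightarrow> \<not> adj G (f (fst s x)) (f (fst s y))"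
  using assms by (simp_all add: Edge_def ready_def adj_def)

lemma aval_Marked [simp]:
  assumes "ready s A" "fst s x < n"
  shows "0 < aval (Marked x) s \<longleftrightarrow> f (fst s x) \<in> A"
  using assms by (auto simp: Marked_def ready_def image_iff)

lemma aval_Square_weight [simp]:
  assumes "ready s A" "fst s x < n"
  shows "aval (Square_weight x) s = (w (f (fst s x)))\<^sup>2"
proof -
  have "w (f (fst s x)) = 1 \<or> w (f (fst s x)) = 2"
    using weight_cases[of "f (fst s x)"] assms by auto
  then show ?thesis
    using assms by (auto simp: Square_weight_def Let_def ready_def)
qed

definition talons :: "ram_state \<Rightarrow> 'v set" where
  "talons s = {f (fst s 5), f (fst s 6), f (fst s 7)}"

definition valid :: "ram_state \<Rightarrow> bool" where
  "valid s \<longleftrightarrow> (\<forall>x\<in>{4,5,6,7}. fst s x < n)"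

definition claw_at :: "'v \<Rightarrow> 'v set \<Rightarrow> bool" where
  "claw_at z T \<longleftrightarrow> independent_set G T \<and> (\<forall>t\<in>T. t = z \<or> adj G z t)"

lemma aval_Claw:
  assumes "ready s A" "valid s"
  shows "0 < aval Claw s \<longleftrightarrow> claw_at (f (fst s 4)) (talons s)"
proof -
  have "adj G x y \<longleftrightarrow> adj G y x" "\<not> adj G x x" for x y
    by (auto simp: adj_iff)
  then show ?thesis
    using assms unfolding valid_def
    by (auto simp: Claw_def claw_at_def talons_def independent_set_def)
qed

lemma aval_Kept:
  assumes "ready s A" "valid s" "fst s 8 < n"
  shows "0 < aval Kept s \<longleftrightarrow> f (fst s 8) \<in> exchange G A (talons s)"
  using assms unfolding valid_def
  by (auto simp: Kept_def exchange_def talons_def neighbours_def)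

lemma weight2_numbered:
  assumes "B \<subseteq> V"
  shows "(\<Sum>v\<in>{0..<n}. if f v \<in> B then (w (f v))\<^sup>2 else 0) = weight2 w B"
proof -
  have "(\<Sum>v\<in>{0..<n}. if f v \<in> B then (w (f v))\<^sup>2 else 0) = (\<Sum>v\<in>V. if v \<in> B then (w v)\<^sup>2 else 0)"
    using sum.reindex_bij_betw[OF numbering, of "\<lambda>v. if v \<in> B then (w v)\<^sup>2 else 0"]
    by (simp add: atLeast0LessThan)
  also have "\<dots> = (\<Sum>v\<in>V \<inter> B. (w v)\<^sup>2)"
    by (simp add: sum.inter_restrict[OF finite_V])
  finally show ?thesis
    using assms by (simp add: weight2_def Int_absorb1)
qed

lemma exchange_subset: "A \<subseteq> V \<Longrightarrow> valid s \<Longrightarrow> exchange G A (talons s) \<subseteq> V"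
  by (auto simp: exchange_def talons_def valid_def)

lemma talons_valid_cong:
  assumes "\<And>x. x \<in> {4,5,6,7} \<Longrightarrow> fst t x = fst s x"
  shows "talons t = talons s \<and> (valid t \<longleftrightarrow> valid s)"
  using assms by (simp add: talons_def valid_def)

lemma sem_compare:
  assumes "ready s A" "valid s"
  shows "ready (sem compare s) A \<and> fst (sem compare s) 9 = weight2 w A \<and>
    fst (sem compare s) 10 = weight2 w (exchange G A (talons s))"
proof -
  let ?E = "exchange G A (talons s)"
  let ?sq = "\<lambda>B v. if f v \<in> B then (w (f v))\<^sup>2 else 0"
  let ?s = "((fst s)(9 := 0, 10 := 0), snd s)"
  let ?c = "When (Marked 8) (Assign 9 (Plus (Var 9) (Square_weight 8))) ;;
            When Kept (Assign 10 (Plus (Var 10) (Square_weight 8)))"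
  \<comment> \<open>Registers 9 and 10 hold the parts of the two squared weights that are due to the
    vertices numbered from \<open>k\<close> on.\<close>
  let ?I = "\<lambda>k t. ready t A \<and> valid t \<and> talons t = talons s \<and>
      fst t 9 = sum (?sq A) {k..<n} \<and> fst t 10 = sum (?sq ?E) {k..<n}"
  have "?I 0 (countdown n (\<lambda>k t. sem ?c ((fst t)(8 := k), snd t)) ?s)"
  proof (rule countdown_invariant[where I = ?I])
    show "?I n ?s"
      using assms by (simp add: talons_def valid_def)
  next
    fix k t assume k: "k < n" and I: "?I (Suc k) t"
    let ?t = "((fst t)(8 := k), snd t)"
    let ?t1 = "sem (When (Marked 8) (Assign 9 (Plus (Var 9) (Square_weight 8)))) ?t"
    let ?t2 = "sem (When Kept (Assign 10 (Plus (Var 10) (Square_weight 8)))) ?t1"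
    have t: "ready ?t A" "fst ?t 8 = k"
      using I by simp_all
    then have t1: "ready ?t1 A" "fst ?t1 8 = k"
      "fst ?t1 9 = fst t 9 + ?sq A k" "fst ?t1 10 = fst t 10"
      using k by auto
    have "talons ?t1 = talons t \<and> (valid ?t1 \<longleftrightarrow> valid t)"
      by (rule talons_valid_cong) auto
    with I have tv1: "talons ?t1 = talons s" "valid ?t1"
      by auto
    have kept: "0 < aval Kept ?t1 \<longleftrightarrow> f k \<in> ?E"
      using aval_Kept[OF t1(1) tv1(2)] t1(2) k tv1(1) by simp
    have sq: "aval (Square_weight 8) ?t1 = (w (f k))\<^sup>2"
      using aval_Square_weight[OF t1(1), of 8] t1(2) k by simp
    have t2: "ready ?t2 A" "fst ?t2 9 = fst ?t1 9" "fst ?t2 10 = fst ?t1 10 + ?sq ?E k"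
      using kept sq t1(1) by (auto simp del: aval_Square_weight simp: sem.simps(4)[of Kept])
    have "talons ?t2 = talons ?t1 \<and> (valid ?t2 \<longleftrightarrow> valid ?t1)"
      by (rule talons_valid_cong) (auto intro!: sem_frame)
    with tv1 have "talons ?t2 = talons s" "valid ?t2"
      by auto
    moreover have "fst ?t2 9 = sum (?sq A) {k..<n}" "fst ?t2 10 = sum (?sq ?E) {k..<n}"
      unfolding t2(2,3) t1(3,4) using I k by (simp_all add: sum.atLeast_Suc_lessThan)
    ultimately show "?I k (sem ?c ?t)"
      using t2(1) by (simp only: sem.simps(3))
  qed
  moreover have "sem compare s = countdown n (\<lambda>k t. sem ?c ((fst t)(8 := k), snd t)) ?s"
    using assms by (simp add: compare_def ready_def)
  ultimately show ?thesis
    using weight2_numbered ready_subset[OF assms(1)] exchange_subset[OF _ assms(2)] by simp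
qed

text \<open>Overwriting the marks in place is safe: of all marks, \<open>Kept\<close> reads only the
  one about to be overwritten. So the marks from \<open>k\<close> on are new, while those below
  \<open>k\<close> are still those of \<open>A\<close>.\<close>

lemma sem_update:
  assumes "ready s A" "valid s"
  shows "ready (sem update s) (exchange G A (talons s))"
proof -
  let ?E = "exchange G A (talons s)"
  let ?I = "\<lambda>k t. valid t \<and> talons t = talons s \<and>
      (\<exists>B. ready t B \<and> (\<forall>v<n. f v \<in> B \<longleftrightarrow> f v \<in> (if k \<le> v then ?E else A)))"
  let ?c = "Put (Plus (Var 2) (Var 8)) Kept"
  have "?I 0 (countdown n (\<lambda>k t. sem ?c ((fst t)(8 := k), snd t)) s)"
  proof (rule countdown_invariant[where I = ?I])
    show "?I n s" using assms by auto
  next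
    fix k t assume k: "k < n" and I: "?I (Suc k) t"
    then obtain B where B: "ready t B"
        "\<And>v. v < n \<Longrightarrow> f v \<in> B \<longleftrightarrow> f v \<in> (if Suc k \<le> v then ?E else A)"
      by blast
    let ?t = "((fst t)(8 := k), snd t)"
    have "talons ?t = talons t \<and> (valid ?t \<longleftrightarrow> valid t)"
      by (rule talons_valid_cong) auto
    then have tv: "talons ?t = talons s \<and> valid ?t"
      using I by blast
    let ?a = "aval Kept ?t" and ?t' = "sem ?c ?t"
    have "0 < ?a \<longleftrightarrow> f k \<in> exchange G B (talons s)"
      using aval_Kept[of ?t B] B(1) tv k by simp
    also have "\<dots> \<longleftrightarrow> f k \<in> ?E"
      using B(2)[OF k] by (simp add: exchange_def)
    finally have a: "0 < ?a \<longleftrightarrow> f k \<in> ?E" .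
    let ?B = "if ?a \<noteq> 0 then insert (f k) B else B - {f k}"
    have "fst t 2 = n * n + n"
      using B(1) by (simp add: ready_def)
    then have "ready ?t' ?B"
      using ready_mark[OF B(1) k, of 8 k ?a] by simp
    moreover have "\<forall>v<n. f v \<in> ?B \<longleftrightarrow> f v \<in> (if k \<le> v then ?E else A)"
    proof (intro allI impI)
      fix v assume "v < n"
      then show "f v \<in> ?B \<longleftrightarrow> f v \<in> (if k \<le> v then ?E else A)"
        using a B(2)[of v] k by (cases "v = k") auto
    qed
    moreover have "talons ?t' = talons ?t \<and> (valid ?t' \<longleftrightarrow> valid ?t)"
      by (rule talons_valid_cong) auto
    then have "talons ?t' = talons s \<and> valid ?t'"
      using tv by blast
    ultimately show "?I k ?t'" by blast
  qed
  moreover have "sem update s = countdown n (\<lambda>k t. sem ?c ((fst t)(8 := k), snd t)) s"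
    using assms by (simp add: update_def ready_def)
  ultimately obtain B where B: "ready (sem update s) B" "\<And>v. v < n \<Longrightarrow> f v \<in> B \<longleftrightarrow> f v \<in> ?E"
    by auto
  moreover have "B = ?E"
    using ready_subset[OF B(1)] exchange_subset[OF ready_subset[OF assms(1)] assms(2)] B(2)
    by (blast elim: obtain_number)
  ultimately show ?thesis by simp
qed

section \<open>Exhaustive search for an improving claw\<close>

lemma sem_try_claw:
  assumes "ready s A" "valid s"
  defines "T \<equiv> talons s"
  shows "ready (sem try_claw s)
    (if claw_at (f (fst s 4)) T \<and> improves G w T A then exchange G A T else A)"
proof -
  have c: "ready (sem compare s) A" "fst (sem compare s) 9 = weight2 w A"
    "fst (sem compare s) 10 = weight2 w (exchange G A T)"
    using sem_compare[OF assms(1,2)] by (auto simp: T_def)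
  have "talons (sem compare s) = T \<and> (valid (sem compare s) \<longleftrightarrow> valid s)"
    unfolding T_def by (rule talons_valid_cong, rule sem_frame) (auto simp: compare_def)
  then have "ready (sem update (sem compare s)) (exchange G A T)"
    using sem_update[OF c(1)] assms(2) by simp
  then show ?thesis
    using aval_Claw[OF assms(1,2)] assms(1) c by (auto simp: try_claw_def improves_def T_def)
qed

text \<open>An exchange that improves changes the set, so \<open>A' = A\<close> certifies that this
  choice of center and talons gives no improving claw.\<close>

lemma try_claw_step:
  assumes "ready s A" "valid s"
  shows "\<exists>A'. ready (sem try_claw s) A' \<and> steps A A' \<and>
    (A' = A \<longrightarrow> \<not> (claw_at (f (fst s 4)) (talons s) \<and> improves G w (talons s) A))"
proof (cases "claw_at (f (fst s 4)) (talons s) \<and> improves G w (talons s) A")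
  case True
  then have "\<exists>d c. is_claw G d c (talons s)"
    using assms(2) by (intro triple_claw[of "f (fst s 4)"]) (auto simp: claw_at_def talons_def valid_def)
  with True have "squareimp_step G w A (exchange G A (talons s))"
    by (auto simp: squareimp_step_def)
  moreover have "exchange G A (talons s) \<noteq> A"
    using True by (auto simp: improves_def)
  ultimately show ?thesis
    using sem_try_claw[OF assms] True by auto
next
  case False
  then show ?thesis
    using sem_try_claw[OF assms] by (auto simp del: de_Morgan_conj)
qed

text \<open>Shared by the four nested loops; \<open>P\<close> fixes the loop variables of the outer
  ones. Every change of the set increases its squared weight, so if the final set is
  \<open>A\<close>, it was \<open>A\<close> in every round, and all certificates \<open>R k\<close>
  concern the same set.\<close>

lemma search_loop:
  assumes x: "3 < x"
    and body: "\<And>s A. ready s A \<Longrightarrow> P s \<Longrightarrow> fst s x < n \<Longrightarrow>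
      \<exists>A'. ready (sem c s) A' \<and> steps A A' \<and> (A' = A \<longrightarrow> R (fst s x) A)"
    and P_assign: "\<And>s k. P s \<Longrightarrow> P ((fst s)(x := k), snd s)"
    and P_sem: "\<And>s. P s \<Longrightarrow> P (sem c s)"
    and s: "ready s A" "P s"
  shows "\<exists>A'. ready (sem (For x c) s) A' \<and> steps A A' \<and> (A' = A \<longrightarrow> (\<forall>k<n. R k A))"
proof -
  let ?I = "\<lambda>k t. P t \<and> (\<exists>A'. ready t A' \<and> steps A A' \<and> (A' = A \<longrightarrow> (\<forall>i<n. k \<le> i \<longrightarrow> R i A)))"
  have "?I 0 (countdown n (\<lambda>k t. sem c ((fst t)(x := k), snd t)) s)"
  proof (rule countdown_invariant[where I = ?I])
    show "?I n s" using s by auto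
  next
    fix k t assume k: "k < n" and I: "?I (Suc k) t"
    let ?t = "((fst t)(x := k), snd t)"
    from I obtain A' where A': "ready t A'" "steps A A'" "A' = A \<longrightarrow> (\<forall>i<n. Suc k \<le> i \<longrightarrow> R i A)"
      by blast
    have "P ?t" using I P_assign by blast
    moreover have "ready ?t A'" using A' x by simp
    ultimately obtain A'' where A'': "ready (sem c ?t) A''" "steps A' A''" "A'' = A' \<longrightarrow> R k A'"
      using body[of ?t A'] k by auto
    have "\<forall>i<n. k \<le> i \<longrightarrow> R i A" if "A'' = A"
    proof -
      have "A' = A"
        using squareimp_steps_weight2[OF A'(2)] squareimp_steps_weight2[OF A''(2)] that by auto
      then show ?thesis
        using A'(3) A''(3) that by (metis le_neq_implies_less Suc_leI)
    qed
    moreover have "steps A A''" using A'(2) A''(2) by simp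
    ultimately show "?I k (sem c ?t)"
      using A''(1) P_sem[OF \<open>P ?t\<close>] by blast
  qed
  then show ?thesis
    using s by (auto simp: ready_def)
qed

lemma sem_sweep:
  assumes "ready s A"
  shows "\<exists>A'. ready (sem sweep s) A' \<and> steps A A' \<and>
    (A' = A \<longrightarrow> (\<forall>z<n. \<forall>i<n. \<forall>j<n. \<forall>k<n.
      \<not> (claw_at (f z) {f i, f j, f k} \<and> improves G w {f i, f j, f k} A)))"
proof -
  let ?none = "\<lambda>z i j k A. \<not> (claw_at (f z) {f i, f j, f k} \<and> improves G w {f i, f j, f k} A)"
  have inner: "\<exists>A'. ready (sem try_claw t) A' \<and> steps A A' \<and>
      (A' = A \<longrightarrow> ?none (fst t 4) (fst t 5) (fst t 6) (fst t 7) A)"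
    if "ready t A" "fst t 4 < n \<and> fst t 5 < n \<and> fst t 6 < n \<and> fst t 7 < n" for t A
    using try_claw_step[OF that(1)] that(2) by (simp add: valid_def talons_def)
  have 7: "\<exists>A'. ready (sem (For 7 try_claw) t) A' \<and> steps A A' \<and>
      (A' = A \<longrightarrow> (\<forall>k<n. ?none (fst t 4) (fst t 5) (fst t 6) k A))"
    if "ready t A" "fst t 4 < n \<and> fst t 5 < n \<and> fst t 6 < n" for t A
  proof (rule search_loop[where P = "\<lambda>s. fst s 4 = fst t 4 \<and> fst s 5 = fst t 5 \<and> fst s 6 = fst t 6"
        and R = "\<lambda>k. ?none (fst t 4) (fst t 5) (fst t 6) k"])
    show "\<exists>A'. ready (sem try_claw s) A' \<and> steps B A' \<and>
        (A' = B \<longrightarrow> (\<lambda>k. ?none (fst t 4) (fst t 5) (fst t 6) k) (fst s 7) B)"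
      if "ready s B" "fst s 4 = fst t 4 \<and> fst s 5 = fst t 5 \<and> fst s 6 = fst t 6" "fst s 7 < n" for s B
      using inner[OF that(1)] that(2,3) \<open>fst t 4 < n \<and> fst t 5 < n \<and> fst t 6 < n\<close> by (simp del: sem.simps)
    show "fst (sem try_claw s) 4 = fst t 4 \<and> fst (sem try_claw s) 5 = fst t 5 \<and> fst (sem try_claw s) 6 = fst t 6"
      if "fst s 4 = fst t 4 \<and> fst s 5 = fst t 5 \<and> fst s 6 = fst t 6" for s
      using that by (simp add: sem_frame writes_try_claw del: sem.simps)
  qed (use that in auto)
  have 6: "\<exists>A'. ready (sem (For 6 (For 7 try_claw)) t) A' \<and> steps A A' \<and>
      (A' = A \<longrightarrow> (\<forall>j<n. \<forall>k<n. ?none (fst t 4) (fst t 5) j k A))"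
    if "ready t A" "fst t 4 < n \<and> fst t 5 < n" for t A
  proof (rule search_loop[where P = "\<lambda>s. fst s 4 = fst t 4 \<and> fst s 5 = fst t 5"
        and R = "\<lambda>j A. \<forall>k<n. ?none (fst t 4) (fst t 5) j k A"])
    show "\<exists>A'. ready (sem (For 7 try_claw) s) A' \<and> steps B A' \<and>
        (A' = B \<longrightarrow> (\<lambda>j A. \<forall>k<n. ?none (fst t 4) (fst t 5) j k A) (fst s 6) B)"
      if "ready s B" "fst s 4 = fst t 4 \<and> fst s 5 = fst t 5" "fst s 6 < n" for s B
      using 7[OF that(1)] that(2,3) \<open>fst t 4 < n \<and> fst t 5 < n\<close> by (simp del: sem.simps)
    show "fst (sem (For 7 try_claw) s) 4 = fst t 4 \<and> fst (sem (For 7 try_claw) s) 5 = fst t 5"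
      if "fst s 4 = fst t 4 \<and> fst s 5 = fst t 5" for s
      using that by (simp add: sem_frame writes_try_claw del: sem.simps)
  qed (use that in auto)
  have 5: "\<exists>A'. ready (sem (For 5 (For 6 (For 7 try_claw))) t) A' \<and> steps A A' \<and>
      (A' = A \<longrightarrow> (\<forall>i<n. \<forall>j<n. \<forall>k<n. ?none (fst t 4) i j k A))"
    if "ready t A" "fst t 4 < n" for t A
  proof (rule search_loop[where P = "\<lambda>s. fst s 4 = fst t 4"
        and R = "\<lambda>i A. \<forall>j<n. \<forall>k<n. ?none (fst t 4) i j k A"])
    show "\<exists>A'. ready (sem (For 6 (For 7 try_claw)) s) A' \<and> steps B A' \<and>
        (A' = B \<longrightarrow> (\<lambda>i A. \<forall>j<n. \<forall>k<n. ?none (fst t 4) i j k A) (fst s 5) B)"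
      if "ready s B" "fst s 4 = fst t 4" "fst s 5 < n" for s B
      using 6[OF that(1)] that(2,3) \<open>fst t 4 < n\<close> by (simp del: sem.simps)
    show "fst (sem (For 6 (For 7 try_claw)) s) 4 = fst t 4"
      if "fst s 4 = fst t 4" for s
      using that by (simp add: sem_frame writes_try_claw del: sem.simps)
  qed (use that in auto)
  show ?thesis
    unfolding sweep_def
  proof (rule search_loop[where P = "\<lambda>_. True"])
    show "\<exists>A'. ready (sem (For 5 (For 6 (For 7 try_claw))) s) A' \<and> steps B A' \<and>
        (A' = B \<longrightarrow> (\<forall>i<n. \<forall>j<n. \<forall>k<n. ?none (fst s 4) i j k B))"
      if "ready s B" "fst s 4 < n" for s B
      using 5 that by blast
  qed (use assms in auto)
qed

section \<open>Progress of the sweeps towards a local optimum\<close>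

definition locally_optimal :: "'v set \<Rightarrow> bool" where
  "locally_optimal A \<longleftrightarrow> \<not> (\<exists>A'. squareimp_step G w A A')"

text \<open>By \<open>improving_claw_triple\<close>, a sweep that changes nothing has tried every
  candidate for an improving claw.\<close>

lemma sem_sweep_cases:
  assumes "ready s A"
  shows "\<exists>A'. ready (sem sweep s) A' \<and> steps A A' \<and> (locally_optimal A' \<or> weight2 w A < weight2 w A')"
proof -
  obtain A' where A': "ready (sem sweep s) A'" "steps A A'"
    "A' = A \<Longrightarrow> \<forall>z<n. \<forall>i<n. \<forall>j<n. \<forall>k<n.
      \<not> (claw_at (f z) {f i, f j, f k} \<and> improves G w {f i, f j, f k} A)"
    using sem_sweep[OF assms] by blast
  have "locally_optimal A'" if eq: "A' = A"
    unfolding locally_optimal_def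
  proof
    assume "\<exists>A''. squareimp_step G w A' A''"
    then obtain d c T where T: "is_claw G d c T" "improves G w T A"
      unfolding eq by (auto simp: squareimp_step_def)
    then obtain z x y u where t: "{z, x, y, u} \<subseteq> V" "T = {x, y, u}" "independent_set G T"
        "\<And>t. t \<in> T \<Longrightarrow> t = z \<or> adj G z t"
      using improving_claw_triple by blast
    then have "claw_at z T" unfolding claw_at_def by blast
    moreover obtain a b c e where "a < n" "z = f a" "b < n" "x = f b" "c < n" "y = f c" "e < n" "u = f e"
      using t(1) by (metis insert_subset obtain_number)
    ultimately show False
      using A'(3)[OF eq] T(2) t(2) by blast
  qed
  with A' squareimp_steps_weight2[OF A'(2)] show ?thesis by blast
qed

text \<open>Meant for \<open>k\<close> completed sweeps: until local optimality is reached, each of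
  them gains at least 1.\<close>

definition progress :: "nat \<Rightarrow> ram_state \<Rightarrow> bool" where
  "progress k s \<longleftrightarrow> (\<exists>A. ready s A \<and> steps {} A \<and> (locally_optimal A \<or> k \<le> weight2 w A))"

lemma progress_sweep:
  assumes "progress k s"
  shows "progress (Suc k) (sem sweep s)"
proof -
  from assms obtain A where A: "ready s A" "steps {} A" "locally_optimal A \<or> k \<le> weight2 w A"
    by (auto simp: progress_def)
  from sem_sweep_cases[OF A(1)] obtain A' where A': "ready (sem sweep s) A'" "steps A A'"
    "locally_optimal A' \<or> weight2 w A < weight2 w A'" by blast
  have "locally_optimal A' \<or> Suc k \<le> weight2 w A'"
  proof (cases "locally_optimal A")
    case True
    then have "A' = A"
      using A'(2) by (metis converse_rtranclpE locally_optimal_def)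
    with True show ?thesis by simp
  next
    case False
    with A A' show ?thesis by auto
  qed
  moreover have "steps {} A'" using A(2) A'(2) by simp
  ultimately show ?thesis
    unfolding progress_def using A' by blast
qed

lemma progress_fst_0: "progress k s \<Longrightarrow> fst s 0 = n"
  by (auto simp: progress_def ready_def)

lemma ready_init: "ready (sem init (ram_input G w n f)) {}"
proof -
  let ?m = "snd (ram_input G w n f)"
  let ?f = "\<lambda>c k t. sem c ((fst t)(4 := k), snd t)"
  let ?c = "Assign 1 (Plus (Var 1) (Var 0))"
  let ?d = "Assign 9 (Minus (Var 9) (Var 0)) ;; Put (Plus (Var 3) (Var 4)) (Var 9)"
  let ?s1 = "countdown n (?f ?c) (ram_input G w n f)"
  have 1: "fst ?s1 0 = n \<and> snd ?s1 = ?m \<and> fst ?s1 1 + 0 * n = n * n"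
    by (rule countdown_invariant[where I = "\<lambda>k t. fst t 0 = n \<and> snd t = ?m \<and> fst t 1 + k * n = n * n"])
       (auto simp: ram_input_def)
  let ?s2 = "((fst ?s1)(2 := n * n + n, 3 := n * n + n + n, 9 := n * n), ?m)"
  let ?s3 = "countdown n (?f ?d) ?s2"
  have "sem init (ram_input G w n f) = ?s3"
    using 1 by (simp add: init_def ram_input_def)
  moreover have 3: "fst ?s3 0 = n \<and> fst ?s3 1 = n * n \<and> fst ?s3 2 = n * n + n \<and> fst ?s3 3 = n * n + n + n \<and>
      fst ?s3 9 = 0 * n \<and> (\<forall>i<n. 0 \<le> i \<longrightarrow> snd ?s3 (n * n + n + n + i) = i * n) \<and>
      (\<forall>a<n * n + n + n. snd ?s3 a = ?m a)"
    by (rule countdown_invariant[where I = "\<lambda>k t. fst t 0 = n \<and> fst t 1 = n * n \<and> fst t 2 = n * n + n \<and>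
      fst t 3 = n * n + n + n \<and>
      fst t 9 = k * n \<and> (\<forall>i<n. k \<le> i \<longrightarrow> snd t (n * n + n + n + i) = i * n) \<and>
      (\<forall>a<n * n + n + n. snd t a = ?m a)"])
       (use 1 in \<open>auto simp: le_Suc_eq Suc_le_eq\<close>)
  have "?m (i * n + j) = mult G (f i) (f j)" if "i < n" "j < n" for i j
    using row_less[OF that] that by (simp add: ram_input_def)
  moreover have "i * n + j < n * n + n + n" if "i < n" "j < n" for i j
    using row_less[OF that] by simp
  ultimately show ?thesis
    using 3 by (simp add: ready_def) (simp add: ram_input_def)
qed

lemma sem_program:
  "\<exists>A. ready (sem squareimp_program (ram_input G w n f)) A \<and> squareimp_returns G w A"
proof -
  let ?c = "sweep ;; sweep ;; sweep ;; sweep"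
  let ?s = "sem sweep (sem init (ram_input G w n f))"
  have "progress 0 (sem init (ram_input G w n f))"
    using ready_init by (auto simp: progress_def)
  then have s: "progress 1 ?s"
    using progress_sweep by fastforce
  \<comment> \<open>Once index \<open>k\<close> has been processed, \<open>n - k\<close> rounds of
    four sweeps are complete; the additional 1 is the sweep before the loop.\<close>
  have "progress (1 + 4 * (n - 0)) (countdown n (\<lambda>k t. sem ?c ((fst t)(4 := k), snd t)) ?s)"
  proof (rule countdown_invariant)
    show "progress (1 + 4 * (n - n)) ?s" using s by simp
  next
    fix k t assume "k < n" "progress (1 + 4 * (n - Suc k)) t"
    then have "progress (1 + 4 * (n - Suc k)) ((fst t)(4 := k), snd t)"
      by (simp add: progress_def)
    then have "progress (Suc (Suc (Suc (Suc (1 + 4 * (n - Suc k)))))) (sem ?c ((fst t)(4 := k), snd t))"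
      by (simp only: sem.simps progress_sweep)
    moreover have "Suc (Suc (Suc (Suc (1 + 4 * (n - Suc k))))) = 1 + 4 * (n - k)"
      using \<open>k < n\<close> by simp
    ultimately show "progress (1 + 4 * (n - k)) (sem ?c ((fst t)(4 := k), snd t))"
      by (simp only:)
  qed
  then have "progress (1 + 4 * n) (sem squareimp_program (ram_input G w n f))"
    using progress_fst_0[OF s] by (simp add: squareimp_program_def del: sem.simps(3)) (simp add: sem.simps(3))
  then obtain A where A: "ready (sem squareimp_program (ram_input G w n f)) A" "steps {} A"
    "locally_optimal A \<or> 1 + 4 * n \<le> weight2 w A"
    unfolding progress_def by blast
  have "weight2 w A \<le> 4 * n"
    using weight2_le[OF ready_subset[OF A(1)]] bij_betw_same_card[OF numbering] by simp
  with A show ?thesis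
    by (auto simp: squareimp_returns_def locally_optimal_def)
qed

lemma run_program:
  "\<exists>t s. exec (compile squareimp_program 11) (ram_input G w n f) t s \<and>
     t \<le> poly (cost squareimp_program) n \<and> squareimp_returns G w (ram_output n f s)"
proof -
  let ?s0 = "ram_input G w n f"
  \<comment> \<open>By \<open>vars_program\<close> the program mentions only registers below 11, so
    the temporary values start there.\<close>
  obtain t s where s: "exec (compile squareimp_program 11) ?s0 t s"
      "t \<le> poly (cost squareimp_program) (fst ?s0 0)" "agree 11 s (sem squareimp_program ?s0)"
    using exec_compile[OF vars_program writes_program, of ?s0] by auto
  obtain A where A: "ready (sem squareimp_program ?s0) A" "squareimp_returns G w A"
    using sem_program by blast
  have "ram_output n f s = A"
    using A(1) s(3) by (auto simp: ram_output_def ready_def agree_def)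
  then have "squareimp_returns G w (ram_output n f s)"
    using A(2) by simp
  moreover have "fst ?s0 0 = n" by (simp add: ram_input_def)
  then have "t \<le> poly (cost squareimp_program) n"
    using s(2) by simp
  ultimately show ?thesis using s(1) by blast
qed

end

section \<open>Polynomial running time and approximation ratio\<close>

theorem theorem3:
  "\<exists>(P :: ram) (p :: nat poly). \<forall>(V :: 'v set) (U :: 'v \<Rightarrow> 'a set) G w.
     hereditary_23_collection V U \<and> G = intersection_graph V U \<and> w = intersection_weight U \<longrightarrow>
       implements_squareimp P G w (poly p (card (verts G))) \<and>
       (\<forall>k A. (squareimp_step G w ^^ k) {} A \<longrightarrow> k \<le> poly p (card (verts G))) \<and>
       (\<forall>A. squareimp_returns G w A \<longrightarrow>
          independent_set G A \<and>
          (\<forall>A_opt. is_wMIS G w A_opt \<longrightarrow> real (weight w A_opt) \<le> 3 / 2 * real (weight w A)))"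
proof (intro exI allI impI)
  fix V :: "'v set" and U :: "'v \<Rightarrow> 'a set" and G w
  assume a: "hereditary_23_collection V U \<and> G = intersection_graph V U \<and> w = intersection_weight U"
  then interpret collection V U by unfold_locales simp
  \<comment> \<open>The cost of the compiled program plus \<open>4 * n\<close>, the bound on the
    number of iterations under arbitrary choices of claws; the sum dominates both.\<close>
  let ?p = "cost squareimp_program + [:0, 4:]"
  have G: "G = intersection_graph V U" "w = intersection_weight U" using a by simp_all
  have "implements_squareimp (compile squareimp_program 11) G w (poly ?p (card (verts G)))"
    unfolding implements_squareimp_def
  proof (intro allI impI)
    fix f assume f: "bij_betw f {..<card (verts G)} (verts G)"
    interpret numbered_collection V U "card (verts G)" f
      using f G by unfold_locales simp
    from run_program show "\<exists>t s. exec (compile squareimp_program 11) (ram_input G w (card (verts G)) f) t s \<and>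
        t \<le> poly ?p (card (verts G)) \<and>
        squareimp_returns G w (ram_output (card (verts G)) f s)"
      unfolding G[symmetric] by fastforce
  qed
  moreover have "k \<le> poly ?p (card (verts G))" if "(squareimp_step G w ^^ k) {} A" for k A
    using squareimp_steps_bound[of k A] that unfolding G by simp
  moreover have "independent_set G A \<and>
      (\<forall>A_opt. is_wMIS G w A_opt \<longrightarrow> real (weight w A_opt) \<le> 3 / 2 * real (weight w A))"
    if "squareimp_returns G w A" for A
  proof (intro conjI allI impI)
    show "independent_set G A"
      using squareimp_approximation that independent_empty unfolding G by blast
  next
    fix B assume "is_wMIS G w B"
    then have "2 * weight w B \<le> 3 * weight w A"
      using squareimp_approximation that unfolding G is_wMIS_def by blast
    then show "real (weight w B) \<le> 3 / 2 * real (weight w A)"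
      by linarith
  qed
  ultimately show "implements_squareimp (compile squareimp_program 11) G w (poly ?p (card (verts G))) \<and>
      (\<forall>k A. (squareimp_step G w ^^ k) {} A \<longrightarrow> k \<le> poly ?p (card (verts G))) \<and>
      (\<forall>A. squareimp_returns G w A \<longrightarrow> independent_set G A \<and>
          (\<forall>A_opt. is_wMIS G w A_opt \<longrightarrow> real (weight w A_opt) \<le> 3 / 2 * real (weight w A)))"
    by blast
qed

end
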